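(* Let $m\ge 0$, $p\ge 2m+1$, $0\le k\le m+1$ be integers, $\Omega=[a,b]$, and $u\in C^{p+2}(\bar\Omega)$. Let $W_{p,m,\Gamma_\Omega}$ be the piecewise Hermite-Jacobi interpolant of $u$ on a partition $\Gamma_\Omega$ of $\Omega$ from a quasi-uniform family (as described in the context), with element lengths $h_j$, midpoints $m_j$ and $H=\max_j h_j$. Then $$\begin{aligned}\Vert u-W_{p,m,\Gamma_\Omega}\Vert_{k,\Omega}^2&=\sum_{j=1}^N\left(\frac{h_j}{2}\right)^{2p-2k+3}\left(\frac{u^{(p+1)}(m_j)}{(p-k+1)!}\right)^2\sum_{i=0}^{m-k+1}\big(\hat J_{p-k+1,i}^{\,m-k}\big)^2\big(J_{-1,p-k+1-2i}\big)^2\frac{2}{2(p-k+1-2i)+1}+\mathcal{O}(H^{2p+3-2k})\\&\le \tilde C(p,m)\,H^{2p-2k+2}\,\Vert u\Vert_{p+1}^2+\mathcal{O}(H^{2p+3-2k}),\end{aligned}$$ where $\tilde C(p,m)$ depends only on $p$ and $m$.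
   Context: Partition: $\Gamma_\Omega=\{a=x_0<x_1<\cdots<x_N=b\}$, $\Omega_j=(x_{j-1},x_j)$, $h_j=x_j-x_{j-1}$, $m_j=(x_{j-1}+x_j)/2$, $H=\max_j h_j$, $\beta H=\min_j h_j$ where $\beta$ is bounded below by a positive constant independent of $N$. The $\mathcal{O}$ is as $H\to 0$ over such partitions, with constant independent of the partition (it may depend on $u$, $p$, $m$, $k$, $\Omega$ and the lower bound on $\beta$). $\Vert\cdot\Vert_{k,\Omega}$ is the $H^k(\Omega)$ norm, and $\Vert u\Vert_{p+1}$ is the $H^{p+1}(\Omega)$ norm. $P_n$ is the Legendre polynomial of degree $n$. For integers $n\ge -1$, $r\ge 2n+2$ let $J_{n,r}=\frac{2^{r-n-2}(r-n-2)!(r-2n-2)!}{(2r-2n-3)!}$ (with $J_{-1,0}=1$); for $q\ge 0$ let $\mathcal{J}_q^{-n-2}(\mu)=J_{n,q+2n+2}P_{q+n+1}^{(n+1)}(\mu)$. For $n\ge -1$, $r\ge 2n+2$ set $\hat J_{r,0}^{\,n}=1$ and, for $1\le i\le n+1$, $$\hat J_{r,i}^{\,n}=(-1)^i\binom{n+1}{i}\frac{\prod_{j=0}^{2i-1}(r-j)}{\prod_{j=0}^{i-1}(2r-2j-2i+1)\prod_{j=0}^{i-1}(2r-2n-2i-1+2j)}.$$ Piecewise interpolant: let $\mu_2<\cdots<\mu_{p-2m}$ be the $p-2m-1$ roots of $\mathcal{J}_{p-2m-1}^{-m-2}$ (real, simple, in $(-1,1)$; none if $p=2m+1$). $W_{p,m,\Gamma_\Omega}$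 is the function which on each $\bar\Omega_j$ is the polynomial of degree at most $p$ whose derivatives of order $0,\ldots,m$ agree with those of $u$ at $x_{j-1}$ and $x_j$, and which agrees with $u$ at the points $m_j+h_j\mu_i/2$, $i=2,\ldots,p-2m$. *)

theory Defs
  imports
    "HOL-Analysis.Analysis"
    "HOL-Computational_Algebra.Polynomial"
    "HOL-Library.Landau_Symbols"
begin

section \<open>Functions of class C^k on a closed interval\<close>

text \<open>Iterated derivative relative to \<open>S\<close>; for \<open>S = {a..b}\<close> with \<open>a < b\<close> this is the ordinary
  derivative in the interior and the one-sided derivative at the endpoints.\<close>

primrec nth_deriv_within :: "real set \<Rightarrow> nat \<Rightarrow> (real \<Rightarrow> real) \<Rightarrow> real \<Rightarrow> real" where
  "nth_deriv_within S 0 f = f"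
| "nth_deriv_within S (Suc n) f =
     (\<lambda>x. vector_derivative (nth_deriv_within S n f) (at x within S))"

definition Ck_on :: "nat \<Rightarrow> real set \<Rightarrow> (real \<Rightarrow> real) \<Rightarrow> bool" where
  "Ck_on k S f \<longleftrightarrow>
     (\<forall>i<k. \<forall>x\<in>S. nth_deriv_within S i f differentiable (at x within S)) \<and>
     continuous_on S (nth_deriv_within S k f)"

section \<open>Sobolev norms on an open interval\<close>

definition L2_space :: "real \<Rightarrow> real \<Rightarrow> (real \<Rightarrow> real) set" where
  "L2_space a b = {f. set_borel_measurable lebesgue {a<..<b} f \<and>
                      set_integrable lebesgue {a<..<b} (\<lambda>x. (f x)\<^sup>2)}"

definition test_functions :: "real \<Rightarrow> real \<Rightarrow> (real \<Rightarrow> real) set" where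
  "test_functions a b = {\<phi>. (\<forall>n x. ((deriv ^^ n) \<phi>) field_differentiable (at x)) \<and>
                            (\<exists>c d. a < c \<and> d < b \<and> (\<forall>x. x \<notin> {c..d} \<longrightarrow> \<phi> x = 0))}"

definition has_weak_deriv ::
  "real \<Rightarrow> real \<Rightarrow> nat \<Rightarrow> (real \<Rightarrow> real) \<Rightarrow> (real \<Rightarrow> real) \<Rightarrow> bool" where
  "has_weak_deriv a b i f g \<longleftrightarrow> f \<in> L2_space a b \<and> g \<in> L2_space a b \<and>
     (\<forall>\<phi>\<in>test_functions a b.
        (LINT x:{a<..<b}|lebesgue. f x * (deriv ^^ i) \<phi> x) =
        (-1) ^ i * (LINT x:{a<..<b}|lebesgue. g x * \<phi> x))"

text \<open>Weak derivatives are unique only up to null sets, so an arbitrary representative is chosen;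
  the norm does not depend on it. The norm is meaningful for functions in \<open>H^k(a,b)\<close> only, i.e.
  those for which all the weak derivatives of order at most \<open>k\<close> exist in \<open>L^2\<close>.\<close>

definition weak_deriv :: "real \<Rightarrow> real \<Rightarrow> nat \<Rightarrow> (real \<Rightarrow> real) \<Rightarrow> real \<Rightarrow> real" where
  "weak_deriv a b i f = (SOME g. has_weak_deriv a b i f g)"

definition sobolev_norm :: "nat \<Rightarrow> real \<Rightarrow> real \<Rightarrow> (real \<Rightarrow> real) \<Rightarrow> real" where
  "sobolev_norm k a b f =
     sqrt (\<Sum>i\<le>k. LINT x:{a<..<b}|lebesgue. (weak_deriv a b i f x)\<^sup>2)"

section \<open>Legendre polynomials, Hermite-Jacobi polynomials and coefficients\<close>

text \<open>Rodrigues' formula.\<close>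

definition legendre :: "nat \<Rightarrow> real poly" where
  "legendre n = smult (1 / (2 ^ n * fact n)) ((pderiv ^^ n) ([:-1, 0, 1:] ^ n))"

text \<open>\<open>J_coeff n r\<close> is \<open>J_{n,r}\<close>, used for \<open>n \<ge> -1\<close> and \<open>r \<ge> 2 n + 2\<close>; under these constraints
  all the arguments of \<open>nat\<close> are nonnegative except in the separate case \<open>n = -1, r = 0\<close>.\<close>

definition J_coeff :: "int \<Rightarrow> int \<Rightarrow> real" where
  "J_coeff n r =
     (if n = -1 \<and> r = 0 then 1
      else 2 ^ nat (r - n - 2) * fact (nat (r - n - 2)) * fact (nat (r - 2 * n - 2))
             / fact (nat (2 * r - 2 * n - 3)))"

text \<open>\<open>HJ_poly n q\<close> is the polynomial with upper index \<open>-n-2\<close> and lower index \<open>q\<close>.\<close>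

definition HJ_poly :: "int \<Rightarrow> nat \<Rightarrow> real poly" where
  "HJ_poly n q =
     smult (J_coeff n (int q + 2 * n + 2))
       ((pderiv ^^ nat (n + 1)) (legendre (nat (int q + n + 1))))"

definition J_hat :: "int \<Rightarrow> int \<Rightarrow> nat \<Rightarrow> real" where
  "J_hat n r i =
     (if i = 0 then 1
      else (-1) ^ i * real (nat (n + 1) choose i) *
        (\<Prod>j<2 * i. of_int (r - int j)) /
        ((\<Prod>j<i. of_int (2 * r - 2 * int j - 2 * int i + 1)) *
         (\<Prod>j<i. of_int (2 * r - 2 * n - 2 * int i - 1 + 2 * int j))))"

section \<open>Partitions\<close>

text \<open>A partition is the strictly increasing list of its nodes \<open>x\<^sub>0, \<dots>, x\<^sub>N\<close>; the elements are
  numbered by \<open>1, \<dots>, N\<close>.\<close>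

definition is_partition :: "real \<Rightarrow> real \<Rightarrow> real list \<Rightarrow> bool" where
  "is_partition a b xs \<longleftrightarrow>
     2 \<le> length xs \<and> sorted_wrt (<) xs \<and> hd xs = a \<and> last xs = b"

definition num_elems :: "real list \<Rightarrow> nat" where
  "num_elems xs = length xs - 1"

definition elem_len :: "real list \<Rightarrow> nat \<Rightarrow> real" where
  "elem_len xs j = xs ! j - xs ! (j - 1)"

definition elem_mid :: "real list \<Rightarrow> nat \<Rightarrow> real" where
  "elem_mid xs j = (xs ! (j - 1) + xs ! j) / 2"

definition mesh :: "real list \<Rightarrow> real" where
  "mesh xs = Max (elem_len xs ` {1..num_elems xs})"

definition min_len :: "real list \<Rightarrow> real" where
  "min_len xs = Min (elem_len xs ` {1..num_elems xs})"

text \<open>The quasi-uniform family with lower bound \<open>\<beta>\<^sub>0\<close> for the ratio \<open>min_len / mesh\<close>.\<close>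

definition quasi_uniform :: "real \<Rightarrow> real \<Rightarrow> real \<Rightarrow> real list set" where
  "quasi_uniform \<beta>\<^sub>0 a b = {xs. is_partition a b xs \<and> \<beta>\<^sub>0 * mesh xs \<le> min_len xs}"

text \<open>The filter \<open>H \<rightarrow> 0\<close> over the family. A bound in \<open>O[refinement \<beta>\<^sub>0 a b]\<close> has a constant that
  is uniform over all the partitions in the family with sufficiently small \<open>H\<close>.\<close>

definition refinement :: "real \<Rightarrow> real \<Rightarrow> real \<Rightarrow> real list filter" where
  "refinement \<beta>\<^sub>0 a b = inf (filtercomap mesh (at_right 0)) (principal (quasi_uniform \<beta>\<^sub>0 a b))"

section \<open>The piecewise Hermite-Jacobi interpolant\<close>

text \<open>\<open>W\<close> is determined on \<open>{a..b}\<close> only.\<close>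

definition is_HJ_interpolant ::
  "nat \<Rightarrow> nat \<Rightarrow> real \<Rightarrow> real \<Rightarrow> (real \<Rightarrow> real) \<Rightarrow> real list \<Rightarrow> (real \<Rightarrow> real) \<Rightarrow> bool" where
  "is_HJ_interpolant p m a b u xs W \<longleftrightarrow>
     (\<forall>j\<in>{1..num_elems xs}. \<exists>P :: real poly.
        degree P \<le> p \<and>
        (\<forall>x\<in>{xs ! (j - 1)..xs ! j}. W x = poly P x) \<and>
        (\<forall>i\<le>m. \<forall>x\<in>{xs ! (j - 1), xs ! j}.
           poly ((pderiv ^^ i) P) x = nth_deriv_within {a..b} i u x) \<and>
        (\<forall>\<mu>. poly (HJ_poly (int m) (p - 2 * m - 1)) \<mu> = 0 \<longrightarrow>
           poly P (elem_mid xs j + elem_len xs j * \<mu> / 2) =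
             u (elem_mid xs j + elem_len xs j * \<mu> / 2)))"

section \<open>The leading term of the squared error\<close>

definition leading_term ::
  "nat \<Rightarrow> nat \<Rightarrow> nat \<Rightarrow> real \<Rightarrow> real \<Rightarrow> (real \<Rightarrow> real) \<Rightarrow> real list \<Rightarrow> real" where
  "leading_term p m k a b u xs =
     (\<Sum>j = 1..num_elems xs.
        (elem_len xs j / 2) ^ (2 * p + 3 - 2 * k) *
        (nth_deriv_within {a..b} (p + 1) u (elem_mid xs j) / fact (p + 1 - k))\<^sup>2 *
        (\<Sum>i\<le>m + 1 - k.
           (J_hat (int m - int k) (int p - int k + 1) i)\<^sup>2 *
           (J_coeff (-1) (int p - int k + 1 - 2 * int i))\<^sup>2 *
           (2 / (2 * (real p - real k + 1 - 2 * real i) + 1))))"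

end

theory Submission
  imports Defs
begin

text \<open>
  On an element with midpoint \<open>m\<^sub>j\<close> and length \<open>h\<close> the error \<open>u - W\<close> equals
  \<open>(h/2)\<^sup>p\<^sup>+\<^sup>1 u\<^sup>(\<^sup>p\<^sup>+\<^sup>1\<^sup>)(m\<^sub>j) / (p+1)!\<close> times a rescaled monic polynomial \<open>\<Phi>\<close> of degree \<open>p + 1\<close>, up to a
  function whose derivatives of order \<open>i\<close> are \<open>O(h\<^sup>p\<^sup>+\<^sup>2\<^sup>-\<^sup>i)\<close>; the latter has enough zeros for Rolle's
  theorem to bound it by its highest derivative. Up to a factor \<open>\<Phi>\<close> is the \<open>(m+1)\<close>-fold integral of
  the Legendre polynomial of degree \<open>p - m\<close>, so its \<open>k\<close>-th derivative is an \<open>(m+1-k)\<close>-fold integral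
  whose Legendre expansion is explicit, and orthogonality gives the squared norm. Summation over the
  elements yields the expansion; derivatives of order below \<open>k\<close> only contribute to the remainder. The
  inequality holds because the leading term is a midpoint sum for the integral of
  \<open>(u\<^sup>(\<^sup>p\<^sup>+\<^sup>1\<^sup>))\<^sup>2\<close>. The error is only piecewise smooth, and the Sobolev norm is computed from an
  arbitrary weak derivative, so uniqueness of weak derivatives almost everywhere is needed too.
\<close>

text \<open>Counting powers of the length decides the form of all estimates. On one element the
  derivative of order \<open>i\<close> of the error has a main part of size h^(p+1-i) and a
  correction smaller by one power, so the integrated cross term is of size h^(2p+4-2i). In the
  summation one factor h_j is always kept aside, because the lengths add up to \<open>b - a\<close>;
  the number of elements then never enters, and exactly one power of H is lost. At order
  \<open>k\<close> this leaves H^(2p+3-2k). At an order \<open>i < k\<close> even the whole squared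
  error sums to H^(2p+2-2i), which already has at least one power of H to spare.

  The stated coefficients refer to monic Legendre polynomials: \<open>J_coeff (-1)\<close> is the
  normalising factor and \<open>J_hat\<close> the coefficient with respect to the normalised
  polynomials. This is why the error polynomial is taken monic, and why its derivative of order
  \<open>k\<close> has the leading coefficient (p+1)!/(p+1-k)!, which turns the (p+1)! of the Taylor
  coefficient into the (p-k+1)! of the result.\<close>

lemma poly_ext: "(\<And>x. poly p x = poly q x) \<Longrightarrow> p = (q :: real poly)"
  using poly_eq_poly_eq_iff by blast

section \<open>Derivatives of powers of x^2 - 1 and Legendre polynomials\<close>

definition quad :: "real poly" where
  "quad = [:-1, 0, 1:]"

text \<open>By Rodrigues' formula \<open>rod n n\<close> is a multiple of the Legendre polynomial of
  degree \<open>n\<close>; smaller \<open>j\<close> give iterated antiderivatives of it, larger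
  \<open>j\<close> derivatives. One family thus contains the nodal polynomial, the error polynomial
  and the derivatives of the latter.\<close>

definition rod :: "nat \<Rightarrow> nat \<Rightarrow> real poly" where
  "rod n j = (pderiv ^^ j) (quad ^ n)"

lemma poly_quad [simp]: "poly quad x = x\<^sup>2 - 1"
  by (simp add: quad_def power2_eq_square)

lemma pderiv_quad [simp]: "pderiv quad = [:0, 2:]"
  by (simp add: quad_def pderiv_pCons)

lemma rod_0 [simp]: "rod n 0 = quad ^ n"
  by (simp add: rod_def)

lemma pderiv_rod [simp]: "pderiv (rod n j) = rod n (Suc j)"
  by (simp add: rod_def)

lemma higher_pderiv_rod [simp]: "(pderiv ^^ i) (rod n j) = rod n (i + j)"
  by (simp add: rod_def funpow_add)

lemma legendre_rod: "legendre n = smult (1 / (2 ^ n * fact n)) (rod n n)"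
  by (simp add: legendre_def rod_def quad_def)

lemmas pderiv_rules = pderiv_add pderiv_smult pderiv_mult pderiv_pCons

lemma rod_Suc_1: "rod (Suc n) (Suc 0) = smult (2 * (real n + 1)) ([:0, 1:] * quad ^ n)"
  by (simp add: rod_def pderiv_power_Suc algebra_simps del: power_Suc)

text \<open>The power y = (x^2 - 1)^n satisfies (x^2 - 1) y' = 2 n x y, and differentiating this
  \<open>j + 1\<close> times gives the equation. For \<open>j = n\<close> it is Legendre's
  equation.\<close>

lemma rod_ode:
  "(x\<^sup>2 - 1) * poly (rod n (Suc (Suc j))) x + 2 * (real j + 1 - real n) * x * poly (rod n (Suc j)) x
     + (real j + 1) * (real j - 2 * real n) * poly (rod n j) x = 0"
proof -
  let ?L = "\<lambda>j. quad * rod n (Suc (Suc j))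
      + smult (2 * (real j + 1 - real n)) ([:0, 1:] * rod n (Suc j))
      + smult ((real j + 1) * (real j - 2 * real n)) (rod n j)"
  have L: "?L j = 0" for j
  proof (induction j)
    case 0
    have 1: "quad * rod n (Suc 0) = smult (2 * real n) ([:0, 1:] * rod n 0)"
    proof (cases n)
      case 0
      then show ?thesis
        by (simp add: rod_def)
    next
      case (Suc k)
      show ?thesis
        by (rule poly_ext) (simp add: Suc rod_Suc_1 algebra_simps)
    qed
    have 2: "pderiv (quad * rod n (Suc 0)) = pderiv (smult (2 * real n) ([:0, 1:] * rod n 0))"
      using 1 by (simp only:)
    show ?case
    proof (rule poly_ext)
      fix x
      show "poly (?L 0) x = poly 0 x"
        using arg_cong[OF 2, of "\<lambda>p. poly p x"]
        by (simp add: pderiv_rules algebra_simps del: rod_0)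
    qed
  next
    case (Suc j)
    have 2: "pderiv (?L j) = 0"
      using Suc.IH by (simp only: pderiv_0)
    show ?case
    proof (rule poly_ext)
      fix x
      show "poly (?L (Suc j)) x = poly 0 x"
        using arg_cong[OF 2, of "\<lambda>p. poly p x"]
        by (simp add: pderiv_rules algebra_simps)
    qed
  qed
  show ?thesis
    using arg_cong[OF L[of j], of "\<lambda>p. poly p x"] by (simp add: algebra_simps power2_eq_square)
qed

lemma degree_rod: "degree (rod n j) = 2 * n - j"
  by (simp add: rod_def quad_def degree_higher_pderiv degree_power_eq)

lemma coeff_rod_lead: "coeff (rod n j) (2 * n - j) = (if j \<le> 2 * n then fact (2 * n) / fact (2 * n - j) else 0)"
proof -
  have d: "degree (quad ^ n) = 2 * n"
    by (simp add: quad_def degree_power_eq)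
  have "lead_coeff (quad ^ n) = 1"
    by (simp add: lead_coeff_power quad_def)
  then have c: "coeff (quad ^ n) (2 * n) = 1"
    using d by simp
  show ?thesis
    using d pochhammer_product[of "2 * n - j" "2 * n" "1 :: real"]
    by (auto simp: rod_def coeff_higher_pderiv c pochhammer_fact coeff_eq_0 pochhammer_eq_0_iff)
qed

lemma rod_top: "rod n (2 * n) = [:fact (2 * n):]"
  using coeff_rod_lead[of n "2 * n"] degree_rod[of n "2 * n"]
  by (metis coeff_pCons_0 degree_eq_zeroE diff_self_eq_0 div_by_1 fact_0 le_refl)

text \<open>Descending induction on \<open>s\<close>: differentiating the identity for \<open>s + 1\<close> and applying
  the differential equation gives the one for \<open>s\<close>.\<close>

lemma rod_reflect:
  assumes "s \<le> n"
  shows "smult (fact (n + s)) (rod n (n - s)) = smult (fact (n - s)) (quad ^ s * rod n (n + s))"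
  using assms
proof (induction s rule: inc_induct)
  case base
  show ?case
    by (simp add: rod_top flip: mult_2)
next
  case (step s)
  obtain i where i: "n - s = Suc i" "n - Suc s = i"
    using step.hyps by (metis Suc_diff_Suc)
  have n: "real n = real s + real i + 1"
    using i step.hyps by auto
  have "pderiv (smult (fact (n + Suc s)) (rod n i)) =
      pderiv (smult (fact i) (quad ^ Suc s * rod n (n + Suc s)))"
    using step.IH i by simp
  then have 1: "fact (n + Suc s) * poly (rod n (Suc i)) x =
      fact i * (x\<^sup>2 - 1) ^ s * (2 * (real s + 1) * x * poly (rod n (Suc (n + s))) x
        + (x\<^sup>2 - 1) * poly (rod n (Suc (Suc (n + s)))) x)" for x
    unfolding pderiv_smult pderiv_mult pderiv_power_Suc
    by (drule_tac arg_cong[of _ _ "\<lambda>p. poly p x"])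
      (simp add: algebra_simps del: fact_Suc)
  show ?case
  proof (rule poly_ext)
    fix x
    have "2 * (real s + 1) * x * poly (rod n (Suc (n + s))) x
        + (x\<^sup>2 - 1) * poly (rod n (Suc (Suc (n + s)))) x
      = (real n + real s + 1) * (real i + 1) * poly (rod n (n + s)) x"
      using rod_ode[of x n "n + s"] unfolding of_nat_add n by Groebner_Basis.algebra
    with 1[of x] have "fact (n + Suc s) * poly (rod n (Suc i)) x =
      fact i * (x\<^sup>2 - 1) ^ s * ((real n + real s + 1) * (real i + 1) * poly (rod n (n + s)) x)"
      by simp
    then have "(real n + real s + 1) * (fact (n + s) * poly (rod n (Suc i)) x) =
      (real n + real s + 1) * (fact (Suc i) * ((x\<^sup>2 - 1) ^ s * poly (rod n (n + s)) x))"
      by (simp add: algebra_simps)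
    then have "fact (n + s) * poly (rod n (Suc i)) x =
      fact (Suc i) * ((x\<^sup>2 - 1) ^ s * poly (rod n (n + s)) x)"
      unfolding mult_cancel_left by simp
    then show "poly (smult (fact (n + s)) (rod n (n - s))) x =
      poly (smult (fact (n - s)) (quad ^ s * rod n (n + s))) x"
      by (simp add: i del: fact_Suc)
  qed
qed

lemma rod_root:
  assumes "s \<le> n" "poly (rod n (n + s)) x = 0"
  shows "poly (rod n (n - s)) x = 0"
  using arg_cong[OF rod_reflect[OF assms(1)], of "\<lambda>p. poly p x"] assms(2) by simp

text \<open>Both endpoints are zeros of order \<open>n\<close> of \<open>quad ^ n\<close>;
  \<open>rod_reflect\<close> exhibits the factor \<open>quad ^ (n - j)\<close> that survives
  \<open>j\<close> differentiations.\<close>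

lemma rod_endpoint:
  assumes "j < n" "x\<^sup>2 = 1"
  shows "poly (rod n j) x = 0"
  using arg_cong[OF rod_reflect[of "n - j" n], of "\<lambda>p. poly p x"] assms
  by (simp add: power_0_left)

text \<open>Leibniz rule with a linear factor. At \<open>j = 0\<close> the truncated
  \<open>j - 1\<close> is harmless, since its coefficient is 0.\<close>

lemma higher_pderiv_mult_X:
  "(pderiv ^^ j) ([:0, 1:] * p) = [:0, 1:] * (pderiv ^^ j) p + smult (real j) ((pderiv ^^ (j - 1)) p)"
proof (induction j)
  case (Suc j)
  have "(pderiv ^^ Suc j) ([:0, 1:] * p) =
      pderiv ([:0, 1:] * (pderiv ^^ j) p + smult (real j) ((pderiv ^^ (j - 1)) p))"
    using Suc by simp
  also have "\<dots> = [:0, 1:] * (pderiv ^^ Suc j) p + smult (real (Suc j)) ((pderiv ^^ (Suc j - 1)) p)"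
    by (rule poly_ext, cases j) (simp_all add: pderiv_rules algebra_simps)
  finally show ?case .
qed simp

text \<open>The condition x^2 = 1 treats both endpoints at once. The derivative of
  \<open>quad ^ Suc n\<close> is a multiple of x times \<open>quad ^ n\<close>; in the Leibniz rule
  the term with the lower derivative vanishes at the endpoints, so each degree contributes one
  factor x.\<close>

lemma legendre_endpoint:
  assumes "x\<^sup>2 = 1"
  shows "poly (legendre n) x = x ^ n"
proof -
  have "poly (rod n n) x = 2 ^ n * fact n * x ^ n"
  proof (induction n)
    case (Suc n)
    have "rod (Suc n) (Suc n) = (pderiv ^^ n) (rod (Suc n) (Suc 0))"
      by simp
    also have "\<dots> = smult (2 * (real n + 1)) ([:0, 1:] * rod n n + smult (real n) (rod n (n - 1)))"
      unfolding rod_Suc_1 by (simp only: higher_pderiv_smult higher_pderiv_mult_X rod_def)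
    finally have "poly (rod (Suc n) (Suc n)) x =
        2 * (real n + 1) * (x * poly (rod n n) x + real n * poly (rod n (n - 1)) x)"
      by simp
    also have "real n * poly (rod n (n - 1)) x = 0"
      using rod_endpoint[of "n - 1" n x] assms by (cases "n = 0") auto
    finally show ?case
      using Suc by (simp add: algebra_simps)
  qed simp
  then show ?thesis
    by (simp add: legendre_rod)
qed

text \<open>Differentiating \<open>quad ^ Suc n\<close> twice produces x^2 times
  \<open>quad ^ (n - 1)\<close>; writing x^2 as \<open>quad\<close> plus 1 leaves only powers of
  \<open>quad\<close>, and \<open>n\<close> further derivatives give the recurrence.\<close>

lemma pderiv_legendre_Suc:
  "pderiv (legendre (Suc n)) = smult (2 * real n + 1) (legendre n) + (if n = 0 then 0 else pderiv (legendre (n - 1)))"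
proof -
  have 2: "pderiv (rod (Suc n) (Suc 0)) = smult (2 * (real n + 1) * (2 * real n + 1)) (quad ^ n)
      + (if n = 0 then 0 else smult (4 * (real n + 1) * real n) (quad ^ (n - 1)))"
    unfolding rod_Suc_1
    by (rule poly_ext, cases n)
      (simp_all add: pderiv_rules pderiv_power_Suc del: power_Suc, simp_all add: algebra_simps power2_eq_square)
  have "pderiv (rod (Suc n) (Suc n)) = (pderiv ^^ n) (pderiv (rod (Suc n) (Suc 0)))"
    by simp
  also have "\<dots> = smult (2 * (real n + 1) * (2 * real n + 1)) (rod n n)
      + (if n = 0 then 0 else smult (4 * (real n + 1) * real n) (rod (n - 1) n))"
    unfolding 2 by (simp add: higher_pderiv_add higher_pderiv_smult rod_def)
  finally have e: "rod (Suc n) (Suc (Suc n)) = smult (2 * (real n + 1) * (2 * real n + 1)) (rod n n)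
      + (if n = 0 then 0 else smult (4 * (real n + 1) * real n) (rod (n - 1) n))"
    by simp
  show ?thesis
  proof (cases n)
    case 0
    then show ?thesis
      using e by (simp add: legendre_rod pderiv_smult)
  next
    case (Suc k)
    define c where "c = 1 / (2 ^ k * fact k :: real)"
    have L: "legendre k = smult c (rod k k)"
      "legendre (Suc k) = smult (c / (2 * (real k + 1))) (rod (Suc k) (Suc k))"
      "legendre (Suc (Suc k)) = smult (c / (4 * (real k + 1) * (real k + 2))) (rod (Suc (Suc k)) (Suc (Suc k)))"
      by (simp_all add: legendre_rod c_def) (simp_all add: field_simps)
    show ?thesis
      by (rule poly_ext) (simp add: Suc L pderiv_smult e[unfolded Suc] divide_simps, simp add: algebra_simps)
  qed
qed

lemma pderiv_legendre_diff:
  assumes "1 \<le> l"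
  shows "pderiv (legendre (l + 1) - legendre (l - 1)) = smult (2 * real l + 1) (legendre l)"
  using pderiv_legendre_Suc[of l] assms by (simp add: pderiv_diff)

section \<open>Legendre expansion of iterated integrals of Legendre polynomials\<close>

lemma poly_eqI_pderiv:
  fixes p q :: "real poly"
  assumes "pderiv p = pderiv q" "poly p a = poly q a"
  shows "p = q"
proof -
  obtain h where "p - q = [:h:]"
    using pderiv_iszero[of "p - q"] assms(1) by (auto simp: pderiv_diff)
  moreover from arg_cong[OF this, of "\<lambda>r. poly r a"] have "h = 0"
    using assms(2) by simp
  ultimately show ?thesis
    by simp
qed

text \<open>The product of \<open>s + 1\<close> consecutive odd numbers starting at 2n-2i+1, that
  is, a quotient of two double factorials.\<close>

definition odd_prod :: "nat \<Rightarrow> nat \<Rightarrow> nat \<Rightarrow> real" where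
  "odd_prod n s i = (\<Prod>j\<le>s. 2 * real n - 2 * real i + 1 + 2 * real j)"

lemma odd_prod_pos: "i \<le> n \<Longrightarrow> odd_prod n s i > 0"
  unfolding odd_prod_def by (rule prod_pos) auto

lemma odd_prod_Suc: "odd_prod n (Suc s) i = odd_prod n s i * (2 * real n - 2 * real i + 2 * real s + 3)"
  by (simp add: odd_prod_def algebra_simps)

lemma odd_prod_Suc_Suc: "odd_prod n (Suc s) (Suc i) = (2 * real n - 2 * real i - 1) * odd_prod n s i"
  unfolding odd_prod_def prod.atMost_Suc_shift by (simp add: algebra_simps)

text \<open>Coefficients of the \<open>s\<close>-fold integral of \<open>P\<^sub>n\<close>, found by iterating
  \<open>(2 l + 1) P\<^sub>l = P\<^sub>l\<^sub>+\<^sub>1' - P\<^sub>l\<^sub>-\<^sub>1'\<close>; no constants of integration occur because both sides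
  vanish at \<open>1\<close>.\<close>

definition rod_coeff :: "nat \<Rightarrow> nat \<Rightarrow> nat \<Rightarrow> real" where
  "rod_coeff n s i = (-1) ^ i * real (s choose i) * (2 * (real n + real s - 2 * real i) + 1) / odd_prod n s i"

text \<open>This is the effect of one integration on the coefficients: each Legendre polynomial
  receives contributions from two neighbouring terms. Over the common denominator \<open>E\<close>
  the claim reduces to (k+1)(A+B) = (s+1)B for the binomial coefficients \<open>A\<close> and
  \<open>B\<close>; at \<open>i = Suc s\<close> the first contribution vanishes with its binomial
  coefficient.\<close>

lemma rod_coeff_Suc:
  assumes "i \<le> Suc s" "Suc s \<le> n"
  shows "rod_coeff n (Suc s) i = (-1) ^ i * real (s choose i) / odd_prod n s i
     - (if i = 0 then 0 else (-1) ^ (i - 1) * real (s choose (i - 1)) / odd_prod n s (i - 1))"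
proof (cases i)
  case 0
  have "odd_prod n s 0 > 0"
    by (rule odd_prod_pos) simp
  moreover have "2 * real n + 2 * real s + 3 > 0"
    by linarith
  ultimately show ?thesis
    by (simp add: 0 rod_coeff_def odd_prod_Suc divide_simps)
next
  case (Suc k)
  define A where "A = real (s choose Suc k)"
  define B where "B = real (s choose k)"
  define E where "E = odd_prod n (Suc s) i"
  have E: "E > 0"
    unfolding E_def by (rule odd_prod_pos) (use assms in simp)
  have 1: "real (Suc s choose Suc k) = A + B"
    by (simp add: A_def B_def)
  have "real (Suc k) * (A + B) = real (Suc s) * B"
    using arg_cong[OF Suc_times_binomial_eq[of s k], of real] unfolding of_nat_mult 1 B_def
    by (simp only: mult.commute)
  then have 2: "(A + B) * (2 * (real n + real (Suc s) - 2 * real i) + 1)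
      = A * (2 * real n - 2 * real i + 2 * real s + 3) + B * (2 * real n - 2 * real k - 1)"
    by (simp add: Suc algebra_simps)
  have e1: "1 / odd_prod n s i = (2 * real n - 2 * real i + 2 * real s + 3) / E"
    using E odd_prod_Suc[of n s i] odd_prod_pos[of i n s] assms
    unfolding E_def by (auto simp: field_simps)
  have e2: "1 / odd_prod n s k = (2 * real n - 2 * real k - 1) / E"
    using E odd_prod_Suc_Suc[of n s k] odd_prod_pos[of k n s] assms
    unfolding E_def Suc by (auto simp: field_simps)
  have "rod_coeff n (Suc s) i = (-1) ^ i * ((A + B) * (2 * (real n + real (Suc s) - 2 * real i) + 1)) / E"
    by (simp add: rod_coeff_def 1[symmetric] Suc E_def del: binomial_Suc_Suc)
  also have "\<dots> = (-1) ^ i * A * (1 / odd_prod n s i) - (-1) ^ k * B * (1 / odd_prod n s k)"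
    unfolding 2 e1 e2 using E by (simp add: Suc field_simps)
  finally show ?thesis
    by (simp add: Suc A_def B_def)
qed

lemma sum_telescope_coeffs:
  fixes a X :: "nat \<Rightarrow> real"
  shows "(\<Sum>i\<le>s. a i * (X i - X (Suc i))) =
    (\<Sum>i\<le>Suc s. ((if i \<le> s then a i else 0) - (if i = 0 then 0 else a (i - 1))) * X i)"
proof -
  have "(\<Sum>i\<le>Suc s. (if i = 0 then 0 else a (i - 1)) * X i) = (\<Sum>i\<le>s. a i * X (Suc i))"
    by (subst sum.atMost_Suc_shift) simp
  moreover have "(\<Sum>i\<le>Suc s. (if i \<le> s then a i else 0) * X i) = (\<Sum>i\<le>s. a i * X i)"
    by simp
  ultimately show ?thesis
    by (simp only: left_diff_distrib right_diff_distrib sum_subtractf)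
qed

lemma rod_expansion:
  assumes "s \<le> n"
  shows "rod n (n - s) = smult (2 ^ n * fact n) (\<Sum>i\<le>s. smult (rod_coeff n s i) (legendre (n + s - 2 * i)))"
  using assms
proof (induction s)
  case 0
  show ?case
    by (simp add: rod_coeff_def odd_prod_def legendre_rod)
next
  case (Suc s)
  define a where "a = (\<lambda>i. (-1) ^ i * real (s choose i) / odd_prod n s i)"
  define l where "l = (\<lambda>i. n + s - 2 * i)"
  define Q where "Q = smult (2 ^ n * fact n) (\<Sum>i\<le>s. smult (a i) (legendre (l i + 1) - legendre (l i - 1)))"
  \<comment> \<open>The degree is at least n - s, which is positive here, so \<open>l i - 1\<close>
    is never truncated and the recurrence applies to each term.\<close>
  have l: "1 \<le> l i" "real (l i) = real n + real s - 2 * real i" if "i \<le> s" for i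
    using that Suc.prems by (auto simp: l_def)
  have ps: "pderiv (\<Sum>i\<in>I. f i) = (\<Sum>i\<in>I. pderiv (f i))" for I :: "nat set" and f :: "nat \<Rightarrow> real poly"
    using higher_pderiv_sum[of "Suc 0"] by simp
  have "pderiv Q = smult (2 ^ n * fact n) (\<Sum>i\<le>s. smult (a i) (smult (2 * real (l i) + 1) (legendre (l i))))"
    unfolding Q_def pderiv_smult ps using pderiv_legendre_diff l by simp
  also have "\<dots> = smult (2 ^ n * fact n) (\<Sum>i\<le>s. smult (rod_coeff n s i) (legendre (n + s - 2 * i)))"
  proof -
    have "smult (a i) (smult (2 * real (l i) + 1) (legendre (l i))) = smult (rod_coeff n s i) (legendre (n + s - 2 * i))"
      if "i \<le> s" for i
    proof -
      have "n + s - 2 * i = l i"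
        by (simp add: l_def)
      then show ?thesis
        using l[OF that] by (simp add: a_def rod_coeff_def)
    qed
    then show ?thesis
      by simp
  qed
  also have "\<dots> = rod n (n - s)"
    using Suc by simp
  also have "\<dots> = pderiv (rod n (n - Suc s))"
    using Suc.prems by (simp add: Suc_diff_Suc)
  finally have "rod n (n - Suc s) = Q"
  proof (rule poly_eqI_pderiv[OF sym])
    show "poly (rod n (n - Suc s)) 1 = poly Q 1"
      using rod_endpoint[of "n - Suc s" n 1] Suc.prems
      by (simp add: Q_def poly_sum legendre_endpoint)
  qed
  also have "Q = smult (2 ^ n * fact n) (\<Sum>i\<le>Suc s. smult (rod_coeff n (Suc s) i) (legendre (n + Suc s - 2 * i)))"
  proof (rule poly_ext)
    fix x
    define X where "X = (\<lambda>i. poly (legendre (n + Suc s - 2 * i)) x)"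
    have "poly Q x = 2 ^ n * fact n * (\<Sum>i\<le>s. a i * (X i - X (Suc i)))"
    proof -
      have "l i + 1 = n + Suc s - 2 * i" "l i - 1 = n + Suc s - 2 * Suc i" if "i \<le> s" for i
        using that Suc.prems by (auto simp: l_def)
      then show ?thesis
        by (simp add: Q_def poly_sum X_def del: mult_Suc_right)
    qed
    also have "(\<Sum>i\<le>s. a i * (X i - X (Suc i))) = (\<Sum>i\<le>Suc s. rod_coeff n (Suc s) i * X i)"
      unfolding sum_telescope_coeffs using Suc.prems
      by (intro sum.cong refl) (auto simp: rod_coeff_Suc a_def)
    finally show "poly Q x = poly (smult (2 ^ n * fact n)
        (\<Sum>i\<le>Suc s. smult (rod_coeff n (Suc s) i) (legendre (n + Suc s - 2 * i)))) x"
      by (simp add: poly_sum X_def)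
  qed
  finally show ?case .
qed

section \<open>Orthogonality and norms of Legendre polynomials\<close>

lemma has_integral_pderiv:
  fixes a b :: real
  assumes "a \<le> b"
  shows "(poly (pderiv R) has_integral poly R b - poly R a) {a..b}"
  using fundamental_theorem_of_calculus[OF assms, of "poly R" "poly (pderiv R)"]
    poly_DERIV[of R] has_real_derivative_iff_has_vector_derivative has_field_derivative_at_within
  by blast

lemma poly_integrable: "(\<lambda>x. poly p x) integrable_on {a..b :: real}"
  by (rule integrable_continuous_real) (intro continuous_intros)

lemma integral_by_parts_poly:
  fixes a b :: real
  assumes "a \<le> b"
  shows "integral {a..b} (poly (pderiv A * B)) = poly (A * B) b - poly (A * B) a - integral {a..b} (poly (A * pderiv B))"
proof -
  have "integral {a..b} (poly (pderiv A * B)) + integral {a..b} (poly (A * pderiv B)) =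
      integral {a..b} (\<lambda>x. poly (pderiv A * B) x + poly (A * pderiv B) x)"
    by (rule integral_add[symmetric]) (rule poly_integrable)+
  also have "\<dots> = integral {a..b} (poly (pderiv (A * B)))"
    by (rule integral_cong) (simp add: pderiv_mult algebra_simps)
  also have "\<dots> = poly (A * B) b - poly (A * B) a"
    using has_integral_pderiv[OF assms] by (rule integral_unique)
  finally show ?thesis
    by simp
qed

lemma integral_poly_0: "integral {a..b :: real} (poly 0) = 0"
proof -
  have "poly 0 = (\<lambda>_ :: real. 0)"
    by (rule ext) simp
  then show ?thesis
    by simp
qed

lemma integral_poly_smult: "integral {a..b :: real} (poly (smult c p)) = c * integral {a..b} (poly p)"
proof -
  have "poly (smult c p) = (\<lambda>x. c * poly p x)"
    by (rule ext) simp
  then show ?thesis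
    by (simp only: integral_mult_right)
qed

text \<open>Repeated integration by parts: every boundary term contains some \<open>rod n i\<close>
  with \<open>i < n\<close>, which vanishes at both endpoints. With \<open>j = n\<close> it
  annihilates all polynomials of degree below \<open>n\<close>.\<close>

lemma integral_rod_mult:
  assumes "j \<le> n"
  shows "integral {-1..1} (poly (rod n n * Q)) =
    (-1) ^ j * integral {-1..1} (poly (rod n (n - j) * (pderiv ^^ j) Q))"
  using assms
proof (induction j)
  case (Suc j)
  have "rod n (n - j) = pderiv (rod n (n - Suc j))"
    using Suc.prems by (simp add: Suc_diff_Suc)
  then have "integral {-1..1} (poly (rod n (n - j) * (pderiv ^^ j) Q)) =
      - integral {-1..1} (poly (rod n (n - Suc j) * (pderiv ^^ Suc j) Q))"
    using rod_endpoint[of "n - Suc j" n 1] rod_endpoint[of "n - Suc j" n "-1"] Suc.prems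
    by (simp only: integral_by_parts_poly) simp
  with Suc show ?case
    by (simp del: poly_mult)
qed simp

lemma legendre_orthogonal_lower:
  assumes "degree Q < n"
  shows "integral {-1..1} (poly (legendre n * Q)) = 0"
proof -
  have "degree ((pderiv ^^ (n - 1)) Q) = 0"
    using assms by (simp add: degree_higher_pderiv)
  then have "pderiv ((pderiv ^^ (n - 1)) Q) = 0"
    by (simp add: pderiv_eq_0_iff)
  moreover have "(pderiv ^^ n) Q = pderiv ((pderiv ^^ (n - 1)) Q)"
    using assms by (cases n) auto
  ultimately have "(pderiv ^^ n) Q = 0"
    by simp
  then have "integral {-1..1} (poly (rod n n * Q)) = 0"
    using integral_rod_mult[of n n Q] by (simp add: integral_poly_0)
  then show ?thesis
    by (simp add: legendre_rod integral_poly_smult)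
qed

lemma degree_legendre [simp]: "degree (legendre n) = n"
  by (simp add: legendre_rod degree_rod)

lemma legendre_orthogonal:
  assumes "l \<noteq> n"
  shows "integral {-1..1} (poly (legendre l * legendre n)) = 0"
  using assms legendre_orthogonal_lower[of "legendre n" l] legendre_orthogonal_lower[of "legendre l" n]
  by (cases "l < n") (auto simp: mult.commute)

text \<open>The integral of P_(n+1)' P_n is evaluated twice. By parts only the boundary value 2
  remains, since P_n' has too low a degree to matter; by the recurrence for P_(n+1)' it is 2n+1
  times the squared norm.\<close>

lemma legendre_norm: "integral {-1..1} (poly (legendre n * legendre n)) = 2 / (2 * real n + 1)"
proof -
  have 1: "integral {-1..1} (poly (pderiv (legendre (Suc n)) * legendre n)) = 2"
  proof -
    have "integral {-1..1} (poly (legendre (Suc n) * pderiv (legendre n))) = 0"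
      by (rule legendre_orthogonal_lower) (simp add: degree_pderiv)
    moreover have "(-1) ^ n * (-1) ^ n = (1 :: real)"
      by (simp flip: power_mult_distrib)
    ultimately show ?thesis
      by (simp add: integral_by_parts_poly legendre_endpoint)
  qed
  have 2: "integral {-1..1} (poly ((if n = 0 then 0 else pderiv (legendre (n - 1))) * legendre n)) = 0"
    using legendre_orthogonal_lower[of "pderiv (legendre (n - 1))" n]
    by (auto simp: degree_pderiv mult.commute integral_poly_0)
  have "poly (pderiv (legendre (Suc n)) * legendre n) x =
      (2 * real n + 1) * poly (legendre n * legendre n) x
      + poly ((if n = 0 then 0 else pderiv (legendre (n - 1))) * legendre n) x" for x
    unfolding pderiv_legendre_Suc by (simp add: algebra_simps)
  then have "integral {-1..1} (poly (pderiv (legendre (Suc n)) * legendre n)) =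
      integral {-1..1} (\<lambda>x. (2 * real n + 1) * poly (legendre n * legendre n) x
      + poly ((if n = 0 then 0 else pderiv (legendre (n - 1))) * legendre n) x)"
    by presburger
  also have "\<dots> = integral {-1..1} (\<lambda>x. (2 * real n + 1) * poly (legendre n * legendre n) x)
      + integral {-1..1} (poly ((if n = 0 then 0 else pderiv (legendre (n - 1))) * legendre n))"
    by (rule integral_add; (rule poly_integrable | intro integrable_continuous_real continuous_intros))
  also have "\<dots> = (2 * real n + 1) * integral {-1..1} (poly (legendre n * legendre n))"
    using 2 by (simp only: integral_mult_right)
  finally show ?thesis
    using 1 by (simp add: field_simps)
qed

lemma integral_legendre_sum:
  assumes "finite I" "inj_on l I"
  shows "integral {-1..1} (\<lambda>x. (poly (\<Sum>i\<in>I. smult (c i) (legendre (l i))) x)\<^sup>2) =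
    (\<Sum>i\<in>I. (c i)\<^sup>2 * (2 / (2 * real (l i) + 1)))"
proof -
  have "integral {-1..1} (\<lambda>x. (poly (\<Sum>i\<in>I. smult (c i) (legendre (l i))) x)\<^sup>2) =
    integral {-1..1} (\<lambda>x. \<Sum>i\<in>I. \<Sum>j\<in>I. c i * c j * poly (legendre (l i) * legendre (l j)) x)"
    by (simp add: power2_eq_square poly_sum sum_product algebra_simps)
  also have "\<dots> = (\<Sum>i\<in>I. \<Sum>j\<in>I. c i * c j * integral {-1..1} (poly (legendre (l i) * legendre (l j))))"
    using assms(1) by (subst integral_sum, simp, intro integrable_continuous_real continuous_intros)
      (intro sum.cong refl, subst integral_sum, simp, intro integrable_continuous_real continuous_intros,
       simp only: integral_mult_right)
  also have "\<dots> = (\<Sum>i\<in>I. \<Sum>j\<in>I. if i = j then (c i)\<^sup>2 * (2 / (2 * real (l i) + 1)) else 0)"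
    using assms(2) by (intro sum.cong refl) (simp add: legendre_norm[simplified] legendre_norm power2_eq_square legendre_orthogonal inj_on_eq_iff del: poly_mult)
  also have "\<dots> = (\<Sum>i\<in>I. (c i)\<^sup>2 * (2 / (2 * real (l i) + 1)))"
    using assms(1) by simp
  finally show ?thesis .
qed


section \<open>Double factorials and the coefficients \<open>J_hat\<close> and
  \<open>J_coeff\<close>\<close>

definition odd_fact :: "nat \<Rightarrow> real" where
  "odd_fact l = (\<Prod>j<l. 2 * real j + 1)"

lemma odd_fact_pos: "odd_fact l > 0"
  unfolding odd_fact_def by (rule prod_pos) auto

lemma odd_fact_Suc: "odd_fact (Suc l) = odd_fact l * (2 * real l + 1)"
  by (simp add: odd_fact_def)

lemma odd_fact_add: "odd_fact (a + b) = odd_fact a * (\<Prod>j<b. 2 * (real a + real j) + 1)"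
  by (induction b) (simp_all add: odd_fact_Suc)

lemma fact_double_odd_fact: "fact (2 * l) = 2 ^ l * fact l * odd_fact l"
proof (induction l)
  case (Suc l)
  have "fact (2 * Suc l) = (2 * real l + 2) * (2 * real l + 1) * fact (2 * l)"
    by (simp add: algebra_simps)
  then show ?case
    unfolding Suc by (simp add: odd_fact_Suc algebra_simps)
qed (simp add: odd_fact_def)

text \<open>As \<open>odd_fact l\<close> is (2l-1)!!, the right-hand side is the reciprocal of the
  leading coefficient of the Legendre polynomial of degree \<open>l\<close>.\<close>

lemma J_coeff_odd_fact: "J_coeff (-1) (int l) = fact l / odd_fact l"
proof (cases l)
  case 0
  then show ?thesis
    by (simp add: J_coeff_def odd_fact_def)
next
  case (Suc k)
  have "nat (2 * int l - 2 * (-1) - 3) = 2 * k + 1"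
    by (simp add: Suc)
  then have "J_coeff (-1) (int l) = 2 ^ k * fact k * fact l / fact (2 * k + 1)"
    by (simp add: J_coeff_def Suc del: fact_Suc) (simp add: nat_add_distrib)
  also have "fact (2 * k + 1) = fact (2 * l) / (2 * (real k + 1))"
    by (simp add: Suc field_simps)
  also have "\<dots> = 2 ^ k * fact k * odd_fact l"
    unfolding fact_double_odd_fact by (simp add: Suc field_simps)
  finally show ?thesis
    by simp
qed

lemma prod_falling_fact:
  assumes "k \<le> r"
  shows "(\<Prod>j<k. real r - real j) = fact r / fact (r - k)"
  using assms
proof (induction k)
  case (Suc k)
  have "r - k = Suc (r - Suc k)"
    using Suc.prems by simp
  then have "fact (r - k) = (real r - real k) * fact (r - Suc k)"
    by (metis fact_Suc of_nat_diff Suc.prems Suc_leD)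
  then show ?case
    using Suc by simp
qed simp

text \<open>The leading coefficient of \<open>rod n (n - s)\<close> is (2n)!/(n+s)!, so the factor
  in front of \<open>rod_coeff\<close> is the one that makes the expansion of
  \<open>rod n (n - s)\<close> monic. The identity thus matches the coefficients of the theorem with
  those of \<open>rod_expansion\<close>.\<close>

lemma J_hat_coeff:
  assumes "i \<le> s" "s \<le> n"
  shows "J_hat (int s - 1) (int (n + s)) i * J_coeff (-1) (int (n + s) - 2 * int i) =
    fact (n + s) * 2 ^ n * fact n / fact (2 * n) * rod_coeff n s i"
proof -
  define l where "l = n + s - 2 * i"
  have l: "int (n + s) - 2 * int i = int l" "n + s = l + 2 * i" "real l = real n + real s - 2 * real i"
    using assms by (auto simp: l_def)
  define D1 where "D1 = (\<Prod>j<i. 2 * (real (l + 1) + real j) + 1)"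
  define D2 where "D2 = (\<Prod>j<i. 2 * (real (n - i) + real j) + 1)"
  \<comment> \<open>Both denominators of \<open>J_hat\<close> become quotients of double factorials;
    the first product runs downwards and is therefore reversed.\<close>
  have D1: "(\<Prod>j<i. real_of_int (2 * int (n + s) - 2 * int j - 2 * int i + 1)) = D1"
    unfolding D1_def by (subst prod.nat_diff_reindex[symmetric], rule prod.cong) (auto simp: l)
  have D2: "(\<Prod>j<i. real_of_int (2 * int (n + s) - 2 * (int s - 1) - 2 * int i - 1 + 2 * int j)) = D2"
    unfolding D2_def using assms by (intro prod.cong) auto
  have N: "(\<Prod>j<2 * i. real_of_int (int (n + s) - int j)) = fact (n + s) / fact l"
    using prod_falling_fact[of "2 * i" "n + s"] unfolding l(2) by simp
  have H: "J_hat (int s - 1) (int (n + s)) i = (-1) ^ i * real (s choose i) * (fact (n + s) / fact l) / (D1 * D2)"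
  proof (cases "i = 0")
    case True
    then show ?thesis
      using l(2) by (simp add: J_hat_def D1_def D2_def)
  next
    case False
    then show ?thesis
      unfolding J_hat_def D1 D2 N by simp
  qed
  have d1: "odd_fact (l + 1 + i) = odd_fact l * (2 * real l + 1) * D1"
    unfolding D1_def odd_fact_add[of "l + 1"] by (simp add: odd_fact_Suc)
  have d2: "odd_fact n = odd_fact (n - i) * D2"
    unfolding D2_def odd_fact_add[symmetric] using assms by simp
  have "odd_fact (n - i + Suc s) = odd_fact (n - i) * odd_prod n s i"
    unfolding odd_fact_add odd_prod_def lessThan_Suc_atMost using assms
    by (intro arg_cong2[of _ _ _ _ "(*)"] prod.cong) auto
  moreover have "n - i + Suc s = l + 1 + i"
    using l(2) assms by simp
  ultimately have o: "odd_prod n s i = odd_fact l * (2 * real l + 1) * D1 / odd_fact (n - i)"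
    using d1 odd_fact_pos[of "n - i"] by (simp add: field_simps)
  have pos: "odd_fact l > 0" "odd_fact (n - i) > 0" "D1 > 0" "D2 > 0" "2 * real l + 1 > 0"
    by (auto simp: odd_fact_pos D1_def D2_def intro!: prod_pos)
  have "rod_coeff n s i = (-1) ^ i * real (s choose i) * odd_fact (n - i) / (odd_fact l * D1)"
    unfolding rod_coeff_def o using pos by (simp add: l(3) divide_simps)
  then show ?thesis
    unfolding H l(1) J_coeff_odd_fact fact_double_odd_fact d2 using pos
    by (simp add: field_simps)
qed

text \<open>The interpolation error of \<open>x\<^sup>p\<^sup>+\<^sup>1\<close> on \<open>[-1, 1]\<close>: the monic multiple of
  \<open>(x\<^sup>2 - 1)\<^sup>m\<^sup>+\<^sup>1 P\<close>, where \<open>P\<close> is the derivative of order \<open>m + 1\<close> of the Legendre polynomial of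
  degree \<open>p - m\<close>; the two forms agree by \<open>rod_reflect\<close>.\<close>

definition HJ_remainder :: "nat \<Rightarrow> nat \<Rightarrow> real poly" where
  "HJ_remainder p m = smult (fact (p + 1) / fact (2 * (p - m))) (rod (p - m) (p - 2 * m - 1))"

lemma higher_pderiv_HJ_remainder:
  assumes "2 * m + 1 \<le> p"
  shows "(pderiv ^^ k) (HJ_remainder p m) = smult (fact (p + 1) / fact (2 * (p - m))) (rod (p - m) (k + (p - 2 * m - 1)))"
  by (simp add: HJ_remainder_def higher_pderiv_smult)

lemma HJ_remainder_endpoint:
  assumes "2 * m + 1 \<le> p" "i \<le> m" "x\<^sup>2 = 1"
  shows "poly ((pderiv ^^ i) (HJ_remainder p m)) x = 0"
  using assms rod_endpoint[of "i + (p - 2 * m - 1)" "p - m" x] by (simp add: higher_pderiv_HJ_remainder)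

lemma HJ_remainder_monic:
  assumes "2 * m + 1 \<le> p"
  shows "(pderiv ^^ (p + 1)) (HJ_remainder p m) = [:fact (p + 1):]"
proof -
  have "p + 1 + (p - 2 * m - 1) = 2 * (p - m)"
    using assms by simp
  then show ?thesis
    using assms by (simp only: higher_pderiv_HJ_remainder rod_top) (simp del: fact_Suc)
qed

text \<open>\<open>HJ_poly\<close> is a multiple of \<open>rod (p - m) (p + 1)\<close>, whose index
  lies \<open>m + 1\<close> above \<open>p - m\<close>. Reflection carries its roots to the index
  \<open>m + 1\<close> below, which is that of \<open>HJ_remainder\<close>.\<close>

lemma HJ_poly_root:
  assumes "2 * m + 1 \<le> p" "poly (rod (p - m) (p + 1)) x = 0"
  shows "poly (HJ_poly (int m) (p - 2 * m - 1)) x = 0" "poly (HJ_remainder p m) x = 0"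
proof -
  have "nat (int (p - 2 * m - 1) + int m + 1) = p - m" "nat (int m + 1) = m + 1" "m + 1 + (p - m) = p + 1"
    using assms by auto
  then show "poly (HJ_poly (int m) (p - 2 * m - 1)) x = 0"
    using assms(2) by (simp only: HJ_poly_def legendre_rod higher_pderiv_smult higher_pderiv_rod poly_smult mult_zero_right)
  have "p - m + (m + 1) = p + 1" "p - m - (m + 1) = p - 2 * m - 1"
    using assms by auto
  then show "poly (HJ_remainder p m) x = 0"
    using rod_root[of "m + 1" "p - m" x] assms by (simp add: HJ_remainder_def)
qed

text \<open>The derivative of order \<open>k\<close> is, up to a factor, the (m+1-k)-fold integral
  of a Legendre polynomial. Once its leading coefficient (p+1)!/(p+1-k)! is split off,
  \<open>J_hat_coeff\<close> supplies the expansion and orthogonality the sum of squares.\<close>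

lemma HJ_remainder_norm:
  assumes "2 * m + 1 \<le> p" "k \<le> m + 1"
  shows "integral {-1..1} (\<lambda>t. (poly ((pderiv ^^ k) (HJ_remainder p m)) t)\<^sup>2) =
    (fact (p + 1) / fact (p + 1 - k))\<^sup>2 * (\<Sum>i\<le>m + 1 - k.
      (J_hat (int m - int k) (int p - int k + 1) i)\<^sup>2 * (J_coeff (-1) (int p - int k + 1 - 2 * int i))\<^sup>2 *
      (2 / (2 * (real p - real k + 1 - 2 * real i) + 1)))"
proof -
  define n where "n = p - m"
  define s where "s = m + 1 - k"
  define c :: real where "c = fact (p + 1) / fact (p + 1 - k)"
  have s: "s \<le> n" "k + (p - 2 * m - 1) = n - s" "n + s = p + 1 - k"
    "int m - int k = int s - 1" "int p - int k + 1 = int (n + s)"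
    "real p - real k + 1 = real (n + s)"
    using assms by (auto simp: n_def s_def)
  have c: "fact (p + 1) / fact (2 * n) * (2 ^ n * fact n) = c * (fact (n + s) * 2 ^ n * fact n / fact (2 * n))"
    unfolding c_def s(3) by (simp add: field_simps)
  have "poly ((pderiv ^^ k) (HJ_remainder p m)) t =
     poly (\<Sum>i\<le>s. smult (fact (p + 1) / fact (2 * n) * (2 ^ n * fact n) * rod_coeff n s i) (legendre (n + s - 2 * i))) t" for t
    unfolding higher_pderiv_HJ_remainder[OF assms(1)] n_def[symmetric] s(2) rod_expansion[OF s(1)]
    by (simp add: poly_sum sum_distrib_left mult.assoc)
  then have "integral {-1..1} (\<lambda>t. (poly ((pderiv ^^ k) (HJ_remainder p m)) t)\<^sup>2) =
    (\<Sum>i\<le>s. (fact (p + 1) / fact (2 * n) * (2 ^ n * fact n) * rod_coeff n s i)\<^sup>2 * (2 / (2 * real (n + s - 2 * i) + 1)))"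
    using s(1) by (simp only:) (rule integral_legendre_sum, auto simp: inj_on_def)
  also have "\<dots> = (\<Sum>i\<le>s. c\<^sup>2 * ((J_hat (int m - int k) (int p - int k + 1) i)\<^sup>2 * (J_coeff (-1) (int p - int k + 1 - 2 * int i))\<^sup>2 *
      (2 / (2 * (real p - real k + 1 - 2 * real i) + 1))))"
  proof (rule sum.cong[OF refl])
    fix i assume "i \<in> {..s}"
    then have i: "i \<le> s" "real (n + s - 2 * i) = real (n + s) - 2 * real i"
      using s(1) by auto
    have "fact (p + 1) / fact (2 * n) * (2 ^ n * fact n) * rod_coeff n s i =
      c * (J_hat (int s - 1) (int (n + s)) i * J_coeff (-1) (int (n + s) - 2 * int i))"
      unfolding c J_hat_coeff[OF i(1) s(1)] by simp
    then show "(fact (p + 1) / fact (2 * n) * (2 ^ n * fact n) * rod_coeff n s i)\<^sup>2 * (2 / (2 * real (n + s - 2 * i) + 1)) =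
      c\<^sup>2 * ((J_hat (int m - int k) (int p - int k + 1) i)\<^sup>2 * (J_coeff (-1) (int p - int k + 1 - 2 * int i))\<^sup>2 *
      (2 / (2 * (real p - real k + 1 - 2 * real i) + 1)))"
      unfolding s(4-6) i(2) by (simp only: power_mult_distrib mult.assoc)
  qed
  finally show ?thesis
    by (simp only: c_def s_def sum_distrib_left)
qed

section \<open>Iterated Rolle theorem\<close>

text \<open>Induction removes the largest zero; the gap to the next one yields a new zero of the
  derivative. Keeping the zeros strictly between \<open>Min Z\<close> and \<open>Max Z\<close> makes
  the new one distinct from the others, and later allows endpoints to be adjoined afresh.\<close>

lemma Rolle_finite_zeros:
  fixes f f' :: "real \<Rightarrow> real"
  assumes "continuous_on {c..d} f" "\<And>x. x \<in> {c<..<d} \<Longrightarrow> (f has_real_derivative f' x) (at x)"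
    and "finite Z" "Z \<subseteq> {c..d}" "\<And>z. z \<in> Z \<Longrightarrow> f z = 0" "card Z = Suc n"
  shows "\<exists>Z'. finite Z' \<and> Z' \<subseteq> {Min Z<..<Max Z} \<and> card Z' = n \<and> (\<forall>z\<in>Z'. f' z = 0)"
  using assms(3-)
proof (induction n arbitrary: Z)
  case 0
  then show ?case
    by (intro exI[of _ "{}"]) auto
next
  case (Suc n)
  define Y where "Y = Z - {Max Z}"
  have ne: "Z \<noteq> {}"
    using Suc.prems by auto
  have Y: "finite Y" "Y \<subseteq> {c..d}" "\<And>z. z \<in> Y \<Longrightarrow> f z = 0" "card Y = Suc n"
    using Suc.prems ne by (auto simp: Y_def)
  then obtain Y' where Y': "finite Y'" "Y' \<subseteq> {Min Y<..<Max Y}" "card Y' = n" "\<forall>z\<in>Y'. f' z = 0"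
    using Suc.IH by blast
  have Yne: "Y \<noteq> {}"
    using Y by auto
  have MY: "Max Y \<in> Y" "Min Y \<in> Y" "Max Z \<in> Z"
    using Y Yne ne Suc.prems by auto
  have lt: "Max Y < Max Z"
    using MY Suc.prems by (auto simp: Y_def less_le)
  have le: "Min Z \<le> Min Y"
    using MY Suc.prems by (auto simp: Y_def)
  have "\<exists>z>Max Y. z < Max Z \<and> (\<lambda>h. f' z * h) = (\<lambda>h. 0)"
  proof (rule Rolle_deriv[OF lt])
    show "f (Max Y) = f (Max Z)"
      using MY Y Suc.prems by simp
    have "c \<le> Max Y" "Max Z \<le> d"
      using MY Y(2) Suc.prems(2) by auto
    then show "continuous_on {Max Y..Max Z} f"
      by (intro continuous_on_subset[OF assms(1)]) auto
    show "(f has_derivative (*) (f' x)) (at x)" if "Max Y < x" "x < Max Z" for x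
    proof -
      have "x \<in> {c<..<d}"
        using \<open>c \<le> Max Y\<close> \<open>Max Z \<le> d\<close> that by simp
      then show ?thesis
        using assms(2) by (simp add: has_field_derivative_def)
    qed
  qed
  then obtain z where z: "Max Y < z" "z < Max Z" "f' z = 0"
    by (auto dest: fun_cong[of _ _ 1])
  have "z \<notin> Y'"
    using Y'(2) z(1) by auto
  moreover have "Min Y \<le> Max Y"
    using MY Y by simp
  ultimately have "insert z Y' \<subseteq> {Min Z<..<Max Z}" "card (insert z Y') = Suc n"
    using Y'(1-3) z(1,2) lt le by (auto simp: subset_iff)
  then show ?case
    using Y' z by (intro exI[of _ "insert z Y'"]) auto
qed

text \<open>While \<open>i < M\<close> both endpoints are adjoined before Rolle is applied, so the
  number of interior zeros grows by one per order; from then on it drops by one.\<close>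

lemma Rolle_iterated:
  fixes F :: "nat \<Rightarrow> real \<Rightarrow> real"
  assumes "c < d"
    and cont: "\<And>i. i < K \<Longrightarrow> continuous_on {c..d} (F i)"
    and der: "\<And>i x. i < K \<Longrightarrow> x \<in> {c<..<d} \<Longrightarrow> (F i has_real_derivative F (Suc i) x) (at x)"
    and ends: "\<And>i. i < M \<Longrightarrow> F i c = 0" "\<And>i. i < M \<Longrightarrow> F i d = 0"
    and Z: "finite Z" "Z \<subseteq> {c<..<d}" "\<And>z. z \<in> Z \<Longrightarrow> F 0 z = 0" "card Z = N"
    and "i \<le> K"
  shows "\<exists>Z'. finite Z' \<and> Z' \<subseteq> {c<..<d} \<and> (\<forall>z\<in>Z'. F i z = 0) \<and> card Z' = (if i \<le> M then N + i else N + 2 * M - i)"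
  using \<open>i \<le> K\<close>
proof (induction i)
  case 0
  show ?case
    using Z by (intro exI[of _ Z]) auto
next
  case (Suc i)
  then obtain Y where Y: "finite Y" "Y \<subseteq> {c<..<d}" "\<forall>z\<in>Y. F i z = 0"
    "card Y = (if i \<le> M then N + i else N + 2 * M - i)"
    by auto
  have step: "\<exists>Z'. finite Z' \<and> Z' \<subseteq> {c<..<d} \<and> (\<forall>z\<in>Z'. F (Suc i) z = 0) \<and> card Z' = card X - 1"
    if X: "finite X" "X \<subseteq> {c..d}" "\<forall>z\<in>X. F i z = 0" for X
  proof (cases "card X")
    case 0
    then show ?thesis
      by (intro exI[of _ "{}"]) auto
  next
    case (Suc n)
    have ne: "X \<noteq> {}"
      using Suc by auto
    obtain Z' where Z': "finite Z'" "Z' \<subseteq> {Min X<..<Max X}" "card Z' = n" "\<forall>z\<in>Z'. F (Suc i) z = 0"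
      using Rolle_finite_zeros[OF cont[of i] der[of i] X(1,2) _ Suc] X(3) \<open>Suc i \<le> K\<close> by (metis Suc_le_lessD)
    have "Min X \<in> X" "Max X \<in> X"
      using X ne by auto
    then have "c \<le> Min X" "Max X \<le> d"
      using X by auto
    then show ?thesis
      using Z' Suc by (intro exI[of _ Z']) (auto simp: subset_iff)
  qed
  show ?case
  proof (cases "i < M")
    case True
    have "card (insert c (insert d Y)) = Suc (Suc (N + i))"
      using Y True \<open>c < d\<close> by (subst card_insert_disjoint; (subst card_insert_disjoint)?) auto
    moreover have "insert c (insert d Y) \<subseteq> {c..d}" "\<forall>z\<in>insert c (insert d Y). F i z = 0"
      using Y ends True \<open>c < d\<close> by auto
    ultimately show ?thesis
      using step[of "insert c (insert d Y)"] Y(1) True by simp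
  next
    case False
    moreover have "Y \<subseteq> {c..d}"
      using Y(2) by auto
    moreover have "card Y - 1 = N + 2 * M - Suc i"
      using False Y(4) by auto
    ultimately show ?thesis
      using step[of Y] Y by simp
  qed
qed

section \<open>Test functions and the fundamental lemma of the calculus of variations\<close>

text \<open>Carrying the derivative as a witness makes the inductions for products and affine
  substitutions direct; \<open>diff_times_deriv\<close> returns to the iterates of
  \<open>deriv\<close> used by \<open>test_functions\<close>.\<close>

fun diff_times :: "nat \<Rightarrow> (real \<Rightarrow> real) \<Rightarrow> bool" where
  "diff_times 0 f = True"
| "diff_times (Suc n) f = (\<exists>f'. (\<forall>x. (f has_real_derivative f' x) (at x)) \<and> diff_times n f')"

lemma diff_times_Suc_imp: "diff_times (Suc n) f \<Longrightarrow> diff_times n f"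
  by (induction n arbitrary: f) auto

lemma diff_times_add: "diff_times n f \<Longrightarrow> diff_times n g \<Longrightarrow> diff_times n (\<lambda>x. f x + g x)"
proof (induction n arbitrary: f g)
  case (Suc n)
  then obtain f' g' where d: "\<forall>x. (f has_real_derivative f' x) (at x)" "diff_times n f'"
    "\<forall>x. (g has_real_derivative g' x) (at x)" "diff_times n g'"
    by auto
  then show ?case
    using Suc.IH[OF d(2,4)] by (auto intro!: exI[of _ "\<lambda>x. f' x + g' x"] derivative_intros)
qed simp

lemma diff_times_mult: "diff_times n f \<Longrightarrow> diff_times n g \<Longrightarrow> diff_times n (\<lambda>x. f x * g x)"
proof (induction n arbitrary: f g)
  case (Suc n)
  then obtain f' g' where d: "\<forall>x. (f has_real_derivative f' x) (at x)" "diff_times n f'"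
    "\<forall>x. (g has_real_derivative g' x) (at x)" "diff_times n g'"
    by auto
  have "diff_times n (\<lambda>x. f' x * g x + g' x * f x)"
    using diff_times_Suc_imp Suc.prems by (intro diff_times_add Suc.IH d(2,4)) auto
  moreover have "((\<lambda>x. f x * g x) has_real_derivative f' x * g x + g' x * f x) (at x)" for x
    using d by (auto intro!: derivative_eq_intros)
  ultimately show ?case
    unfolding diff_times.simps by (intro exI[of _ "\<lambda>x. f' x * g x + g' x * f x"]) simp
qed simp

lemma diff_times_affine: "diff_times n f \<Longrightarrow> diff_times n (\<lambda>x. f (c * x + d))"
proof (induction n arbitrary: f)
  case (Suc n)
  then obtain f' where d: "\<forall>x. (f has_real_derivative f' x) (at x)" "diff_times n f'"
    by auto
  have const: "diff_times n (\<lambda>x. k)" for n and k :: real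
  proof (induction n arbitrary: k)
    case (Suc n)
    then show ?case
      by (auto intro!: exI[of _ "\<lambda>_. 0"] derivative_intros)
  qed simp
  have "((\<lambda>x. f (c * x + d)) has_real_derivative c * f' (c * x + d)) (at x)" for x
  proof -
    have "((\<lambda>x. c * x + d) has_real_derivative c) (at x)"
      by (auto intro!: derivative_eq_intros)
    from DERIV_chain2[OF d(1)[rule_format] this] show ?thesis
      by (simp add: mult.commute)
  qed
  moreover have "diff_times n (\<lambda>x. c * f' (c * x + d))"
    by (intro diff_times_mult const Suc.IH d)
  ultimately show ?case
    unfolding diff_times.simps by (intro exI[of _ "\<lambda>x. c * f' (c * x + d)"]) simp
qed simp

lemma diff_times_deriv:
  assumes "\<And>n. diff_times n f"
  shows "(deriv ^^ n) f field_differentiable (at x)"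
proof -
  have "diff_times k ((deriv ^^ n) f)" for k
    using assms
  proof (induction n arbitrary: k f)
    case (Suc n)
    obtain f' where f': "\<forall>x. (f has_real_derivative f' x) (at x)"
      using Suc.prems[of 1] by auto
    then have d: "deriv f = f'"
      by (auto simp: DERIV_imp_deriv)
    have "diff_times k (deriv f)" for k
    proof -
      obtain g where "\<forall>x. (f has_real_derivative g x) (at x)" "diff_times k g"
        using Suc.prems[of "Suc k"] by auto
      moreover from this have "deriv f = g"
        by (auto simp: DERIV_imp_deriv)
      ultimately show ?thesis
        by simp
    qed
    from Suc.IH[OF this, of k] show ?case
      by (simp add: funpow_swap1)
  qed simp
  from this[of 1] show ?thesis
    by (auto simp: field_differentiable_def)
qed

text \<open>A family closed under differentiation, whence smoothness of its members.\<close>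

definition exp_inv :: "real poly \<Rightarrow> real \<Rightarrow> real" where
  "exp_inv p x = (if x > 0 then poly p (1 / x) * exp (- (1 / x)) else 0)"

lemma exp_inv_div_tendsto: "((\<lambda>x. exp_inv p x / x) \<longlongrightarrow> 0) (at_right 0)"
proof -
  \<comment> \<open>The extra power is needed for the induction, since splitting off the constant
    coefficient multiplies the remaining polynomial by y. Afterwards \<open>k = 1\<close> accounts
    for the division by x.\<close>
  have "((\<lambda>y. poly p y * y ^ k / exp y) \<longlongrightarrow> 0) at_top" for k
  proof (induction p arbitrary: k)
    case (pCons a p)
    have "((\<lambda>y. a * (y ^ k / exp y) + poly p y * y ^ Suc k / exp y) \<longlongrightarrow> a * 0 + 0) at_top"
      by (intro tendsto_intros tendsto_power_div_exp_0 pCons.IH)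
    then show ?case
      by (simp add: algebra_simps add_divide_distrib)
  qed simp
  from this[of 1] have "((\<lambda>y. poly p y * y / exp y) \<longlongrightarrow> 0) at_top"
    by simp
  then have "((\<lambda>x. poly p (inverse x) * inverse x / exp (inverse x)) \<longlongrightarrow> 0) (at_right 0)"
    by (rule filterlim_compose[OF _ filterlim_inverse_at_top_right])
  then show ?thesis
    by (rule Lim_transform_eventually)
      (auto simp: eventually_at_right_field exp_inv_def exp_minus field_simps intro!: exI[of _ 1])
qed

text \<open>With y = 1/x one has dy/dx = -y^2, so p(y) exp(-y) has the derivative y^2 (p(y) - p'(y))
  exp(-y). At 0 the difference quotient tends to 0 because the exponential beats every
  power.\<close>

lemma exp_inv_deriv:
  "(exp_inv p has_real_derivative exp_inv ([:0, 0, 1:] * (p - pderiv p)) x) (at x)"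
proof -
  consider "x < 0" | "x = 0" | "x > 0" by linarith
  then show ?thesis
  proof cases
    case 1
    then have "((\<lambda>_. 0) has_real_derivative 0) (at x)"
      by simp
    then show ?thesis
      using 1 by (rule_tac has_field_derivative_transform_within_open[of _ _ _ "{..<0}"]) (auto simp: exp_inv_def)
  next
    case 2
    have "((\<lambda>y. (exp_inv p y - exp_inv p 0) / (y - 0)) \<longlongrightarrow> 0) (at 0)"
    proof (subst filterlim_at_split, intro conjI)
      show "((\<lambda>y. (exp_inv p y - exp_inv p 0) / (y - 0)) \<longlongrightarrow> 0) (at_left 0)"
        by (rule Lim_transform_eventually[OF tendsto_const])
          (auto simp: eventually_at_left_field exp_inv_def intro!: exI[of _ "-1"])
      show "((\<lambda>y. (exp_inv p y - exp_inv p 0) / (y - 0)) \<longlongrightarrow> 0) (at_right 0)"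
        using exp_inv_div_tendsto[of p] by (simp add: exp_inv_def[of p 0])
    qed
    then have "(exp_inv p has_real_derivative 0) (at 0)"
      by (simp add: has_field_derivative_iff)
    then show ?thesis
      using 2 by (simp add: exp_inv_def[of _ 0])
  next
    case 3
    then have "((\<lambda>x. poly p (1 / x) * exp (- (1 / x))) has_real_derivative
        poly (pderiv p) (1 / x) * (- 1 / x\<^sup>2) * exp (- (1 / x)) + exp (- (1 / x)) * (1 / x\<^sup>2) * poly p (1 / x)) (at x)"
      by (auto intro!: derivative_eq_intros DERIV_chain2[OF poly_DERIV] simp: power2_eq_square)
    then have "((\<lambda>x. poly p (1 / x) * exp (- (1 / x))) has_real_derivative exp_inv ([:0, 0, 1:] * (p - pderiv p)) x) (at x)"
      using 3 by (simp add: exp_inv_def power2_eq_square algebra_simps)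
    then show ?thesis
      using 3 by (rule_tac has_field_derivative_transform_within_open[of _ _ _ "{0<..}"]) (auto simp: exp_inv_def)
  qed
qed

lemma diff_times_exp_inv: "diff_times n (exp_inv p)"
  by (induction n arbitrary: p) (use exp_inv_deriv in \<open>auto intro: exI[of _ "exp_inv _"]\<close>)

text \<open>Since \<open>exp (- 1 / (n y))\<close> tends to \<open>1\<close> for \<open>y > 0\<close>, these tend boundedly to the indicator
  function of \<open>(c, d)\<close>.\<close>

definition bump :: "real \<Rightarrow> real \<Rightarrow> nat \<Rightarrow> real \<Rightarrow> real" where
  "bump c d n x = exp_inv 1 (real (Suc n) * (x - c)) * exp_inv 1 (real (Suc n) * (d - x))"

lemma bump_test_function:
  assumes "a < c" "d < b"
  shows "bump c d n \<in> test_functions a b"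
proof -
  have "diff_times k (\<lambda>x. exp_inv 1 (real (Suc n) * x + (- real (Suc n) * c)) *
      exp_inv 1 (- real (Suc n) * x + real (Suc n) * d))" for k
    by (intro diff_times_mult diff_times_affine diff_times_exp_inv)
  also have "(\<lambda>x. exp_inv 1 (real (Suc n) * x + (- real (Suc n) * c)) *
      exp_inv 1 (- real (Suc n) * x + real (Suc n) * d)) = bump c d n"
    by (auto simp: bump_def algebra_simps)
  finally have "diff_times k (bump c d n)" for k .
  then have "(deriv ^^ i) (bump c d n) field_differentiable (at x)" for i x
    by (rule diff_times_deriv)
  moreover have "bump c d n x = 0" if "x \<notin> {c..d}" for x
    using that by (auto simp: bump_def exp_inv_def zero_less_mult_iff)
  ultimately show ?thesis
    using assms unfolding test_functions_def by blast
qed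

lemma bump_bounds: "0 \<le> bump c d n x" "bump c d n x \<le> 1"
  by (auto simp: bump_def exp_inv_def mult_le_one zero_less_mult_iff)

lemma bump_tendsto: "(\<lambda>n. bump c d n x) \<longlonglongrightarrow> indicat_real {c<..<d} x"
proof (cases "x \<in> {c<..<d}")
  case True
  have *: "(\<lambda>n. exp_inv 1 (real (Suc n) * y)) \<longlonglongrightarrow> 1" if "y > 0" for y
  proof -
    have "(\<lambda>n. exp (- (inverse (real (Suc n)) * (1 / y)))) \<longlonglongrightarrow> exp (- (0 * (1 / y)))"
      by (intro tendsto_intros LIMSEQ_inverse_real_of_nat)
    moreover have "exp_inv 1 (real (Suc n) * y) = exp (- (inverse (real (Suc n)) * (1 / y)))" for n
      using that by (simp add: exp_inv_def inverse_eq_divide del: of_nat_Suc)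
    ultimately show ?thesis
      by simp
  qed
  have "(\<lambda>n. bump c d n x) \<longlonglongrightarrow> 1 * 1"
    unfolding bump_def using True by (intro tendsto_mult *) auto
  then show ?thesis
    using True by simp
next
  case False
  then have "bump c d n x = 0" for n
    by (auto simp: bump_def exp_inv_def zero_less_mult_iff)
  then show ?thesis
    using False by simp
qed

lemma test_function_continuous:
  assumes "\<phi> \<in> test_functions a b"
  shows "continuous_on S ((deriv ^^ i) \<phi>)"
  using assms
  by (intro continuous_at_imp_continuous_on ballI field_differentiable_imp_continuous_at)
    (auto simp: test_functions_def)

lemma borel_measurable_bump [measurable]: "bump c d n \<in> borel_measurable borel"
  by (rule borel_measurable_continuous_onI)
    (use test_function_continuous[OF bump_test_function[of "c - 1" c d "d + 1" n], of UNIV 0] in simp)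

text \<open>Intervals generate the Borel sets, and a Lebesgue set differs from a Borel set by a null
  set, so all integrals of \<open>w\<close> over measurable sets vanish and \<open>w\<close> has the
  same set integrals as 0.\<close>

lemma AE_zero_of_interval_integrals:
  fixes w :: "real \<Rightarrow> real"
  assumes w: "integrable lebesgue w"
    and zero: "\<And>c d. (LINT x:{c..d}|lebesgue. w x) = 0"
  shows "AE x in lebesgue. w x = 0"
proof (rule density_unique_real[OF w, of "\<lambda>_. 0"])
  have i: "set_integrable lebesgue B w" if "B \<in> sets lebesgue" for B
    using w that unfolding set_integrable_def by (intro integrable_mult_indicator)
  have borel: "(LINT x:B|lebesgue. w x) = 0" if "B \<in> sets borel" for B
    using that
  proof (induction rule: borel_set_induct)
    case empty
    show ?case
      by (simp add: set_lebesgue_integral_def)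
  next
    case (interval c d)
    then show ?case
      using zero by simp
  next
    case (compl B)
    \<comment> \<open>Passing to complements requires the integral over the whole line, obtained
      here by exhaustion.\<close>
    have "(\<lambda>n. LINT x:{- real n..real n}|lebesgue. w x) \<longlonglongrightarrow> (LINT x:(\<Union>n. {- real n..real n})|lebesgue. w x)"
      by (rule set_integral_cont_up) (auto simp: incseq_def intro!: i)
    moreover have "(\<Union>n. {- real n..real n}) = UNIV"
    proof (intro equalityI subsetI UNIV_I)
      fix x :: real
      obtain n where "\<bar>x\<bar> \<le> real n"
        using real_arch_simple by blast
      then show "x \<in> (\<Union>n. {- real n..real n})"
        by (intro UN_I[of n]) auto
    qed
    ultimately have "(LINT x:UNIV|lebesgue. w x) = 0"
      by (simp add: zero LIMSEQ_const_iff)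
    moreover have "(LINT x:UNIV|lebesgue. w x) = (LINT x:B|lebesgue. w x) + (LINT x:-B|lebesgue. w x)"
      using compl by (subst set_integral_Un[symmetric]) (auto intro!: i)
    ultimately show ?case
      using compl by simp
  next
    case (union B)
    have "(LINT x:(\<Union>i. B i)|lebesgue. w x) = (\<Sum>i. (LINT x:B i|lebesgue. w x))"
      using union by (intro lebesgue_integral_countable_add i) (auto simp: disjoint_family_on_def)
    then show ?case
      using union by simp
  qed
  fix A :: "real set" assume "A \<in> sets lebesgue"
  then obtain B N N' where BN: "A = B \<union> N" "N \<subseteq> N'" "N' \<in> null_sets lborel" "B \<in> sets borel"
    by (auto elim!: sets_completionE)
  have "(LINT x:A|lebesgue. w x) = (LINT x:B|lebesgue. w x)"
  proof (rule set_integral_cong_set)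
    show "set_borel_measurable lebesgue B w" "set_borel_measurable lebesgue A w"
      using i[of A] i[of B] \<open>A \<in> sets lebesgue\<close> BN(4)
      by (auto simp: set_borel_measurable_def set_integrable_def)
    show "AE x in lebesgue. (x \<in> B) = (x \<in> A)"
      using AE_completion[OF AE_not_in[OF BN(3)]] by eventually_elim (use BN in auto)
  qed
  then show "(LINT x:A|lebesgue. w x) = (LINT x:A|lebesgue. 0)"
    using borel \<open>B \<in> sets borel\<close> by (simp add: set_lebesgue_integral_def)
qed simp

text \<open>Dominated convergence along the functions \<open>bump c d n\<close> turns the condition
  on test functions into vanishing integrals over the intervals (c, d) whose closure lies inside (a,
  b).\<close>

lemma fundamental_lemma:
  fixes w :: "real \<Rightarrow> real"
  assumes w: "set_integrable lebesgue {a<..<b} w"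
    and zero: "\<And>\<phi>. \<phi> \<in> test_functions a b \<Longrightarrow> (LINT x:{a<..<b}|lebesgue. w x * \<phi> x) = 0"
  shows "AE x in lebesgue. x \<in> {a<..<b} \<longrightarrow> w x = 0"
proof -
  define v where "v = (\<lambda>x. indicat_real {a<..<b} x * w x)"
  have v: "integrable lebesgue v"
    using w by (simp add: v_def set_integrable_def)
  have inner: "(LINT x:{c<..<d}|lebesgue. v x) = 0" if "a < c" "d < b" for c d
  proof -
    have "(\<lambda>n. LINT x|lebesgue. v x * bump c d n x) \<longlonglongrightarrow> (LINT x|lebesgue. v x * indicat_real {c<..<d} x)"
    proof (rule integral_dominated_convergence[where w = "\<lambda>x. \<bar>v x\<bar>"])
      show "(\<lambda>x. v x * indicat_real {c<..<d} x) \<in> borel_measurable lebesgue"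
        using v by (intro borel_measurable_times borel_measurable_indicator) auto
      show "(\<lambda>x. v x * bump c d n x) \<in> borel_measurable lebesgue" for n
        using v by (intro borel_measurable_times) (auto intro!: measurable_completion)
      show "AE x in lebesgue. norm (v x * bump c d n x) \<le> \<bar>v x\<bar>" for n
        using bump_bounds[of c d n] by (auto simp: abs_mult mult_left_le)
    qed (use v bump_tendsto in \<open>auto intro!: tendsto_intros\<close>)
    moreover have "(LINT x|lebesgue. v x * bump c d n x) = 0" for n
      using zero[OF bump_test_function[OF that]] by (simp add: v_def set_lebesgue_integral_def mult.assoc)
    ultimately have "(LINT x|lebesgue. v x * indicat_real {c<..<d} x) = 0"
      by (simp add: LIMSEQ_const_iff)
    then show ?thesis
      by (simp add: set_lebesgue_integral_def mult.commute)
  qed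
  have i: "set_integrable lebesgue B v" if "B \<in> sets lebesgue" for B
    using v that unfolding set_integrable_def by (intro integrable_mult_indicator)
  have "(LINT x:{c..d}|lebesgue. v x) = 0" for c d
  proof -
    \<comment> \<open>\<open>v\<close> vanishes outside (a, b), so the interval may be clipped to
      it. Shrinking by 1/(n+1) gives the strict inclusion that \<open>inner\<close> demands.\<close>
    define c' where "c' = max a c"
    define d' where "d' = min b d"
    have "(\<lambda>n. LINT x:{c' + inverse (real (Suc n))<..<d' - inverse (real (Suc n))}|lebesgue. v x) \<longlonglongrightarrow>
      (LINT x:(\<Union>n. {c' + inverse (real (Suc n))<..<d' - inverse (real (Suc n))})|lebesgue. v x)"
    proof (rule set_integral_cont_up)
      show "incseq (\<lambda>n. {c' + inverse (real (Suc n))<..<d' - inverse (real (Suc n))})"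
      proof (intro incseq_SucI subsetI)
        fix n x assume x: "x \<in> {c' + inverse (real (Suc n))<..<d' - inverse (real (Suc n))}"
        have "inverse (real (Suc (Suc n))) \<le> inverse (real (Suc n))"
          by (intro le_imp_inverse_le) auto
        with x show "x \<in> {c' + inverse (real (Suc (Suc n)))<..<d' - inverse (real (Suc (Suc n)))}"
          unfolding greaterThanLessThan_iff by linarith
      qed
    qed (auto intro!: i)
    moreover have "(LINT x:{c' + inverse (real (Suc n))<..<d' - inverse (real (Suc n))}|lebesgue. v x) = 0" for n
    proof (rule inner)
      have "inverse (real (Suc n)) > 0"
        by simp
      then show "a < c' + inverse (real (Suc n))" "d' - inverse (real (Suc n)) < b"
        unfolding c'_def d'_def by linarith+
    qed
    moreover have "(\<Union>n. {c' + inverse (real (Suc n))<..<d' - inverse (real (Suc n))}) = {c'<..<d'}"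
    proof (rule equalityI; rule subsetI)
      fix x assume "x \<in> {c'<..<d'}"
      then obtain n where "inverse (real (Suc n)) < min (x - c') (d' - x)"
        using reals_Archimedean[of "min (x - c') (d' - x)"] by auto
      then show "x \<in> (\<Union>n. {c' + inverse (real (Suc n))<..<d' - inverse (real (Suc n))})"
        by (intro UN_I[of n]) auto
    next
      fix x assume "x \<in> (\<Union>n. {c' + inverse (real (Suc n))<..<d' - inverse (real (Suc n))})"
      then obtain n where n: "c' + inverse (real (Suc n)) < x" "x < d' - inverse (real (Suc n))"
        by auto
      have "inverse (real (Suc n)) > 0"
        by simp
      with n show "x \<in> {c'<..<d'}"
        unfolding greaterThanLessThan_iff by linarith
    qed
    ultimately have "(LINT x:{c'<..<d'}|lebesgue. v x) = 0"
      by (simp add: LIMSEQ_const_iff)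
    moreover have "(LINT x:{c..d}|lebesgue. v x) = (LINT x:{c'<..<d'}|lebesgue. v x)"
      unfolding set_lebesgue_integral_def
    proof (rule integral_cong_AE)
      show "(\<lambda>x. indicat_real {c..d} x *\<^sub>R v x) \<in> borel_measurable lebesgue"
        "(\<lambda>x. indicat_real {c'<..<d'} x *\<^sub>R v x) \<in> borel_measurable lebesgue"
        using i[of "{c..d}"] i[of "{c'<..<d'}"] by (auto simp: set_integrable_def)
      show "AE x in lebesgue. indicat_real {c..d} x *\<^sub>R v x = indicat_real {c'<..<d'} x *\<^sub>R v x"
        using AE_completion[OF AE_lborel_singleton[of c]] AE_completion[OF AE_lborel_singleton[of d]]
        by eventually_elim (auto simp: v_def c'_def d'_def indicator_def)
    qed
    ultimately show ?thesis
      by simp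
  qed
  then have "AE x in lebesgue. v x = 0"
    by (rule AE_zero_of_interval_integrals[OF v])
  then show ?thesis
    by eventually_elim (auto simp: v_def indicator_def)
qed

section \<open>Weak derivatives of piecewise smooth functions\<close>

lemma test_function_deriv:
  assumes "\<phi> \<in> test_functions a b"
  shows "((deriv ^^ i) \<phi> has_real_derivative (deriv ^^ Suc i) \<phi> x) (at x)"
  using assms by (simp add: test_functions_def field_differentiable_derivI)

lemma test_function_endpoints:
  assumes "\<phi> \<in> test_functions a b" "a < b"
  shows "(deriv ^^ i) \<phi> a = 0" "(deriv ^^ i) \<phi> b = 0"
proof -
  obtain c d where cd: "a < c" "d < b" "\<And>x. x \<notin> {c..d} \<Longrightarrow> \<phi> x = 0"
    using assms by (auto simp: test_functions_def)
  have "(deriv ^^ i) \<phi> x = 0" if "x \<notin> {c..d}" for x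
    using that
  proof (induction i arbitrary: x)
    case (Suc i)
    have "((\<lambda>_. 0) has_real_derivative 0) (at x)"
      by simp
    then have "((deriv ^^ i) \<phi> has_real_derivative 0) (at x)"
      by (rule has_field_derivative_transform_within_open[where S = "- {c..d}"]) (use Suc in auto)
    then show ?case
      by (simp add: DERIV_imp_deriv)
  qed (use cd in auto)
  then show "(deriv ^^ i) \<phi> a = 0" "(deriv ^^ i) \<phi> b = 0"
    using cd by auto
qed

lemma set_integrable_bounded:
  fixes g :: "real \<Rightarrow> real"
  assumes "set_borel_measurable lebesgue {a<..<b} g" "\<And>x. x \<in> {a<..<b} \<Longrightarrow> \<bar>g x\<bar> \<le> B"
  shows "set_integrable lebesgue {a<..<b} g"
  unfolding set_integrable_def
proof (rule Bochner_Integration.integrable_bound)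
  show "integrable lebesgue (\<lambda>x. indicat_real {a<..<b} x *\<^sub>R B)"
    using emeasure_lborel_box_finite[of a b] by (intro integrable_scaleR_left integrable_real_indicator) simp_all
  show "(\<lambda>x. indicat_real {a<..<b} x *\<^sub>R g x) \<in> borel_measurable lebesgue"
    using assms(1) by (simp add: set_borel_measurable_def)
  show "AE x in lebesgue. norm (indicat_real {a<..<b} x *\<^sub>R g x) \<le> norm (indicat_real {a<..<b} x *\<^sub>R B)"
    by (rule AE_I2) (use assms(2) in \<open>force simp: indicator_def\<close>)
qed

lemma set_borel_measurable_piecewise:
  fixes g :: "real \<Rightarrow> real"
  assumes "finite S" "continuous_on ({a<..<b} - S) g"
  shows "set_borel_measurable lebesgue {a<..<b} g"
proof -
  have "open ({a<..<b} - S)"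
    using assms(1) by (intro open_Diff finite_imp_closed) auto
  then have 1: "(\<lambda>x. indicat_real ({a<..<b} - S) x *\<^sub>R g x) \<in> borel_measurable lebesgue"
    using borel_measurable_continuous_on_indicator[OF borel_open assms(2)] by (intro measurable_completion) simp
  have "(\<lambda>x. indicat_real {a<..<b} x *\<^sub>R g x) \<in> borel_measurable lebesgue"
    by (rule measurable_discrete_difference[OF 1, of S]) (use assms(1) in \<open>auto simp: countable_finite indicator_def\<close>)
  then show ?thesis
    by (simp add: set_borel_measurable_def)
qed

lemma set_integrable_piecewise:
  fixes g :: "real \<Rightarrow> real"
  assumes "finite S" "continuous_on ({a<..<b} - S) g" "\<And>x. x \<in> {a<..<b} \<Longrightarrow> \<bar>g x\<bar> \<le> B"
  shows "set_integrable lebesgue {a<..<b} g"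
  by (rule set_integrable_bounded[OF set_borel_measurable_piecewise]) (rule assms)+

lemma L2_space_piecewise:
  assumes "finite S" "continuous_on ({a<..<b} - S) g" "\<And>x. x \<in> {a<..<b} \<Longrightarrow> \<bar>g x\<bar> \<le> B"
  shows "g \<in> L2_space a b"
proof -
  have "set_integrable lebesgue {a<..<b} (\<lambda>x. (g x)\<^sup>2)"
  proof (rule set_integrable_piecewise[where B = "B\<^sup>2"])
    show "\<bar>(g x)\<^sup>2\<bar> \<le> B\<^sup>2" if "x \<in> {a<..<b}" for x
      using assms(3)[OF that] by (metis abs_ge_zero abs_power2 power2_abs power_mono)
  qed (use assms in \<open>auto intro!: continuous_intros\<close>)
  then show ?thesis
    using set_borel_measurable_piecewise[OF assms(1,2)] by (simp add: L2_space_def)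
qed

text \<open>On a bounded interval the estimate |g| \<le> 1 + g^2 provides an integrable majorant,
  with the factor \<open>\<phi>\<close> bounded by compactness.\<close>

lemma L2_space_mult_continuous:
  assumes "g \<in> L2_space a b" "continuous_on UNIV \<phi>"
  shows "set_integrable lebesgue {a<..<b} (\<lambda>x. g x * \<phi> x)"
proof -
  have "bounded (\<phi> ` {a..b})"
    using assms(2) by (intro compact_imp_bounded compact_continuous_image) (auto intro: continuous_on_subset)
  then obtain B where B: "\<And>x. x \<in> {a..b} \<Longrightarrow> \<bar>\<phi> x\<bar> \<le> B" "B > 0"
    unfolding bounded_pos by (metis imageI real_norm_def)
  have one: "set_integrable lebesgue {a<..<b} (\<lambda>x. 1 :: real)"
    by (rule set_integrable_piecewise[of "{}" _ _ _ 1]) auto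
  show ?thesis
  proof (rule set_integrable_bound[of _ _ "\<lambda>x. B * (1 + (g x)\<^sup>2)"])
    show "set_integrable lebesgue {a<..<b} (\<lambda>x. B * (1 + (g x)\<^sup>2))"
      using assms one by (intro set_integrable_mult_right set_integral_add) (auto simp: L2_space_def)
    have "\<phi> \<in> borel_measurable lebesgue"
      using assms(2) by (intro measurable_completion) (simp add: borel_measurable_continuous_onI)
    then have "(\<lambda>x. (indicat_real {a<..<b} x *\<^sub>R g x) * \<phi> x) \<in> borel_measurable lebesgue"
      using assms(1) unfolding L2_space_def set_borel_measurable_def by (intro borel_measurable_times) auto
    then show "set_borel_measurable lebesgue {a<..<b} (\<lambda>x. g x * \<phi> x)"
      by (simp add: set_borel_measurable_def mult.assoc)
    show "AE x in lebesgue. x \<in> {a<..<b} \<longrightarrow> norm (g x * \<phi> x) \<le> norm (B * (1 + (g x)\<^sup>2))"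
    proof (rule AE_I2, rule impI)
      fix x assume "x \<in> {a<..<b}"
      then have "\<bar>\<phi> x\<bar> \<le> B"
        using B(1) by auto
      moreover have "\<bar>g x\<bar> \<le> 1 + (g x)\<^sup>2"
        using sum_squares_bound[of "\<bar>g x\<bar>" 1] by (simp add: power2_eq_square)
      ultimately have "\<bar>g x\<bar> * \<bar>\<phi> x\<bar> \<le> (1 + (g x)\<^sup>2) * B"
        by (intro mult_mono) auto
      then show "norm (g x * \<phi> x) \<le> norm (B * (1 + (g x)\<^sup>2))"
        using B(2) by (simp add: abs_mult mult.commute)
    qed
  qed
qed

lemma weak_deriv_unique:
  assumes "has_weak_deriv a b i f g" "has_weak_deriv a b i f h"
  shows "(LINT x:{a<..<b}|lebesgue. (g x)\<^sup>2) = (LINT x:{a<..<b}|lebesgue. (h x)\<^sup>2)"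
proof -
  have L2: "g \<in> L2_space a b" "h \<in> L2_space a b"
    using assms by (auto simp: has_weak_deriv_def)
  have int: "set_integrable lebesgue {a<..<b} (\<lambda>x. g x * \<phi> x)" "set_integrable lebesgue {a<..<b} (\<lambda>x. h x * \<phi> x)"
    if "continuous_on UNIV \<phi>" for \<phi>
    using L2_space_mult_continuous L2 that by auto
  have "AE x in lebesgue. x \<in> {a<..<b} \<longrightarrow> g x - h x = 0"
  proof (rule fundamental_lemma)
    show "set_integrable lebesgue {a<..<b} (\<lambda>x. g x - h x)"
      using int[of "\<lambda>_. 1"] by (intro set_integral_diff) auto
    fix \<phi> assume \<phi>: "\<phi> \<in> test_functions a b"
    have "(-1) ^ i * (LINT x:{a<..<b}|lebesgue. g x * \<phi> x) = (-1) ^ i * (LINT x:{a<..<b}|lebesgue. h x * \<phi> x)"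
      using assms \<phi> by (auto simp: has_weak_deriv_def)
    moreover have "(LINT x:{a<..<b}|lebesgue. g x * \<phi> x - h x * \<phi> x) =
        (LINT x:{a<..<b}|lebesgue. g x * \<phi> x) - (LINT x:{a<..<b}|lebesgue. h x * \<phi> x)"
      using int test_function_continuous[OF \<phi>, of UNIV 0] by (intro set_integral_diff) auto
    ultimately show "(LINT x:{a<..<b}|lebesgue. (g x - h x) * \<phi> x) = 0"
      by (simp add: left_diff_distrib)
  qed
  then show ?thesis
    unfolding set_lebesgue_integral_def
  proof (intro integral_cong_AE)
    show "(\<lambda>x. indicat_real {a<..<b} x *\<^sub>R (g x)\<^sup>2) \<in> borel_measurable lebesgue"
      "(\<lambda>x. indicat_real {a<..<b} x *\<^sub>R (h x)\<^sup>2) \<in> borel_measurable lebesgue"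
      using L2 by (auto simp: L2_space_def set_integrable_def)
  qed (auto simp: indicator_def elim!: eventually_mono)
qed

text \<open>Continuity of \<open>f\<close> across the points of \<open>S\<close> rules out jump
  terms: the product with \<open>\<psi>\<close> is continuous and an antiderivative off a finite
  set.\<close>

lemma integration_by_parts_piecewise:
  fixes f f' \<psi> \<psi>' :: "real \<Rightarrow> real"
  assumes "a < b" "finite S" "continuous_on {a..b} f"
    and f': "\<And>x. x \<in> {a<..<b} - S \<Longrightarrow> (f has_real_derivative f' x) (at x)"
    and "f \<in> L2_space a b" "f' \<in> L2_space a b"
    and \<psi>: "\<And>x. (\<psi> has_real_derivative \<psi>' x) (at x)" "continuous_on UNIV \<psi>'" "\<psi> a = 0" "\<psi> b = 0"
  shows "(LINT x:{a<..<b}|lebesgue. f x * \<psi>' x) = - (LINT x:{a<..<b}|lebesgue. f' x * \<psi> x)"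
proof -
  have c: "continuous_on T \<psi>" for T
    using \<psi>(1) by (meson DERIV_isCont continuous_at_imp_continuous_on)
  have int: "set_integrable lebesgue {a<..<b} (\<lambda>x. f x * \<psi>' x)" "set_integrable lebesgue {a<..<b} (\<lambda>x. f' x * \<psi> x)"
    using assms c by (auto intro!: L2_space_mult_continuous)
  have "((\<lambda>x. f x * \<psi>' x + f' x * \<psi> x) has_integral (f b * \<psi> b - f a * \<psi> a)) {a..b}"
  proof (rule fundamental_theorem_of_calculus_interior_strong[OF assms(2)])
    show "continuous_on {a..b} (\<lambda>x. f x * \<psi> x)"
      using assms c by (intro continuous_intros)
    show "((\<lambda>x. f x * \<psi> x) has_vector_derivative f x * \<psi>' x + f' x * \<psi> x) (at x)" if "x \<in> {a<..<b} - S" for x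
      using f'[OF that] \<psi>(1)[of x]
      by (auto simp flip: has_real_derivative_iff_has_vector_derivative intro!: derivative_eq_intros)
  qed (use assms in auto)
  then have "((\<lambda>x. f x * \<psi>' x + f' x * \<psi> x) has_integral 0) {a<..<b}"
    using \<psi> by (simp add: has_integral_Icc_iff_Ioo)
  moreover have "((\<lambda>x. f x * \<psi>' x + f' x * \<psi> x) has_integral
      (LINT x:{a<..<b}|lebesgue. f x * \<psi>' x) + (LINT x:{a<..<b}|lebesgue. f' x * \<psi> x)) {a<..<b}"
    using int by (intro has_integral_add has_integral_set_lebesgue)
  ultimately have "0 = (LINT x:{a<..<b}|lebesgue. f x * \<psi>' x) + (LINT x:{a<..<b}|lebesgue. f' x * \<psi> x)"
    by (rule has_integral_unique)
  then show ?thesis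
    by simp
qed

lemma has_weak_deriv_cong:
  assumes "has_weak_deriv a b i f g" "\<And>x. x \<in> {a<..<b} \<Longrightarrow> f x = f' x"
  shows "has_weak_deriv a b i f' g"
proof -
  have "indicat_real {a<..<b} x * f x = indicat_real {a<..<b} x * f' x"
    "indicat_real {a<..<b} x * (f x)\<^sup>2 = indicat_real {a<..<b} x * (f' x)\<^sup>2"
    "indicat_real {a<..<b} x * (f x * y) = indicat_real {a<..<b} x * (f' x * y)" for x y
    using assms(2) by (auto simp: indicator_def)
  with assms(1) show ?thesis
    by (simp add: has_weak_deriv_def L2_space_def set_borel_measurable_def set_integrable_def set_lebesgue_integral_def)
qed

text \<open>Derivatives below order \<open>k\<close> are continuous across \<open>S\<close>, while
  the one of order \<open>k\<close> may jump there; its values on \<open>S\<close> are arbitrary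
  apart from being bounded. For the error \<open>S\<close> consists of the nodes, for
  \<open>u\<close> itself it is empty.\<close>

locale piecewise_derivatives =
  fixes a b :: real and k :: nat and S :: "real set" and F :: "nat \<Rightarrow> real \<Rightarrow> real"
  assumes ab: "a < b" and fin: "finite S"
    and cont: "\<And>i. i < k \<Longrightarrow> continuous_on {a..b} (F i)"
    and deriv: "\<And>i x. i < k \<Longrightarrow> x \<in> {a<..<b} - S \<Longrightarrow> (F i has_real_derivative F (Suc i) x) (at x)"
    and cont_top: "continuous_on ({a<..<b} - S) (F k)"
    and bdd_top: "bounded (F k ` {a<..<b})"
begin

lemma F_piecewise:
  assumes "i \<le> k"
  obtains B where "continuous_on ({a<..<b} - S) (F i)" "\<And>x. x \<in> {a<..<b} \<Longrightarrow> \<bar>F i x\<bar> \<le> B"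
proof (cases "i = k")
  case True
  then show ?thesis
    using cont_top bdd_top that unfolding bounded_iff by (metis imageI real_norm_def)
next
  case False
  then have c: "continuous_on {a..b} (F i)"
    using cont assms by simp
  then have "bounded (F i ` {a..b})"
    by (intro compact_imp_bounded compact_continuous_image) auto
  then obtain B where "\<And>x. x \<in> {a..b} \<Longrightarrow> \<bar>F i x\<bar> \<le> B"
    unfolding bounded_iff by (metis imageI real_norm_def)
  with continuous_on_subset[OF c, of "{a<..<b} - S"] show ?thesis
    by (intro that[of B]) (auto simp: subset_iff)
qed

lemma F_L2: "i \<le> k \<Longrightarrow> F i \<in> L2_space a b"
  using F_piecewise L2_space_piecewise[OF fin] by metis

lemma has_weak_deriv_F:
  assumes "i \<le> k"
  shows "has_weak_deriv a b i (F 0) (F i)"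
  unfolding has_weak_deriv_def
proof (intro conjI ballI F_L2)
  fix \<phi> assume \<phi>: "\<phi> \<in> test_functions a b"
  \<comment> \<open>\<open>j\<close> counts the derivatives moved from \<open>\<phi>\<close> to
    \<open>F\<close>. Each move starts from some \<open>F j\<close> with \<open>j < k\<close>, hence
    from a continuous function.\<close>
  have "(LINT x:{a<..<b}|lebesgue. F 0 x * (deriv ^^ i) \<phi> x) =
    (-1) ^ j * (LINT x:{a<..<b}|lebesgue. F j x * (deriv ^^ (i - j)) \<phi> x)" if "j \<le> i" for j
    using that
  proof (induction j)
    case (Suc j)
    then have ij: "i - j = Suc (i - Suc j)"
      by simp
    have "(LINT x:{a<..<b}|lebesgue. F j x * (deriv ^^ (i - j)) \<phi> x) =
      - (LINT x:{a<..<b}|lebesgue. F (Suc j) x * (deriv ^^ (i - Suc j)) \<phi> x)"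
      unfolding ij using Suc.prems assms
      by (intro integration_by_parts_piecewise[OF ab fin] cont deriv F_L2 test_function_deriv[OF \<phi>]
          test_function_continuous[OF \<phi>] test_function_endpoints[OF \<phi> ab]) auto
    with Suc show ?case
      by simp
  qed simp
  from this[of i] show "(LINT x:{a<..<b}|lebesgue. F 0 x * (deriv ^^ i) \<phi> x) =
    (-1) ^ i * (LINT x:{a<..<b}|lebesgue. F i x * \<phi> x)"
    by simp
qed (use assms in auto)

lemma square_integrable: "i \<le> k \<Longrightarrow> (\<lambda>x. (F i x)\<^sup>2) integrable_on {a..b}"
  using F_L2[of i] set_lebesgue_integral_eq_integral(1)[of "{a<..<b}" "\<lambda>x. (F i x)\<^sup>2"]
  by (simp add: L2_space_def integrable_on_Icc_iff_Ioo)

lemma sobolev_norm_square: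
  assumes "\<And>x. x \<in> {a<..<b} \<Longrightarrow> f x = F 0 x"
  shows "(sobolev_norm k a b f)\<^sup>2 = (\<Sum>i\<le>k. integral {a..b} (\<lambda>x. (F i x)\<^sup>2))"
proof -
  have "(LINT x:{a<..<b}|lebesgue. (weak_deriv a b i f x)\<^sup>2) = integral {a..b} (\<lambda>x. (F i x)\<^sup>2)" if "i \<le> k" for i
  proof -
    have h: "has_weak_deriv a b i f (F i)"
      using has_weak_deriv_cong[OF has_weak_deriv_F[OF that]] assms by metis
    then have "has_weak_deriv a b i f (weak_deriv a b i f)"
      unfolding weak_deriv_def by (rule someI[of "has_weak_deriv a b i f"])
    then have "(LINT x:{a<..<b}|lebesgue. (weak_deriv a b i f x)\<^sup>2) = (LINT x:{a<..<b}|lebesgue. (F i x)\<^sup>2)"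
      using h by (rule weak_deriv_unique)
    also have "\<dots> = integral {a<..<b} (\<lambda>x. (F i x)\<^sup>2)"
      using F_L2[OF that] by (intro set_lebesgue_integral_eq_integral(2)) (simp add: L2_space_def)
    finally show ?thesis
      by (simp add: integral_open_interval_real)
  qed
  moreover have "(\<Sum>i\<le>k. integral {a..b} (\<lambda>x. (F i x)\<^sup>2)) \<ge> 0"
    by (intro sum_nonneg integral_nonneg square_integrable) auto
  ultimately show ?thesis
    by (simp add: sobolev_norm_def)
qed

end

section \<open>The interpolation error on one element\<close>

text \<open>Rolle is applied to \<open>quad ^ (p - m)\<close>, which vanishes to order
  \<open>p - m\<close> at both ends. Its derivative of order \<open>p + 1\<close> therefore has
  2(p-m) - (p+1) = p-2m-1 interior zeros.\<close>

lemma HJ_roots: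
  assumes "2 * m + 1 \<le> p"
  shows "\<exists>Z. finite Z \<and> Z \<subseteq> {-1<..<1} \<and> card Z = p - 2 * m - 1 \<and>
    (\<forall>z\<in>Z. poly (HJ_poly (int m) (p - 2 * m - 1)) z = 0 \<and> poly (HJ_remainder p m) z = 0)"
proof -
  have "\<exists>Z. finite Z \<and> Z \<subseteq> {-1<..<1} \<and> (\<forall>z\<in>Z. poly (rod (p - m) (p + 1)) z = 0) \<and>
    card Z = (if p + 1 \<le> p - m then 0 + (p + 1) else 0 + 2 * (p - m) - (p + 1))"
  proof (rule Rolle_iterated[of _ _ "p + 1" "\<lambda>i. poly (rod (p - m) i)" _ "{}"])
    show "(poly (rod (p - m) i) has_real_derivative poly (rod (p - m) (Suc i)) x) (at x)" for i x
      using poly_DERIV[of "rod (p - m) i" x] by simp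
    show "continuous_on {-1..1} (poly (rod (p - m) i))" for i
      by (intro continuous_intros)
    show "poly (rod (p - m) i) (-1) = 0" "poly (rod (p - m) i) 1 = 0" if "i < p - m" for i
      using that by (simp_all add: rod_endpoint)
  qed simp_all
  then obtain Z where Z: "finite Z" "Z \<subseteq> {-1<..<1}" "\<forall>z\<in>Z. poly (rod (p - m) (p + 1)) z = 0"
    "card Z = (if p + 1 \<le> p - m then 0 + (p + 1) else 0 + 2 * (p - m) - (p + 1))"
    by blast
  moreover have "card Z = p - 2 * m - 1"
    unfolding Z(4) using assms by auto
  ultimately show ?thesis
    using HJ_poly_root[OF assms] by blast
qed

lemma higher_pderiv_degree_less: "degree P < n \<Longrightarrow> (pderiv ^^ n) P = (0 :: real poly)"
proof (cases n)
  case (Suc k)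
  assume "degree P < n"
  then have "degree ((pderiv ^^ k) P) = 0"
    by (simp add: degree_higher_pderiv Suc)
  then show ?thesis
    by (simp add: Suc pderiv_eq_0_iff)
qed simp

text \<open>Going down from order \<open>n\<close>, the mean value inequality between a point and a
  zero of \<open>w i\<close> costs one factor \<open>d - c\<close> per order.\<close>

lemma derivative_bound_from_zeros:
  fixes w :: "nat \<Rightarrow> real \<Rightarrow> real"
  assumes "\<And>i x. i < n \<Longrightarrow> x \<in> {c..d} \<Longrightarrow> (w i has_real_derivative w (Suc i) x) (at x within {c..d})"
    and zero: "\<And>i. i < n \<Longrightarrow> \<exists>z\<in>{c..d}. w i z = 0"
    and "\<And>x. x \<in> {c..d} \<Longrightarrow> \<bar>w n x\<bar> \<le> B" "i \<le> n" "x \<in> {c..d}"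
  shows "\<bar>w i x\<bar> \<le> B * (d - c) ^ (n - i)"
  using \<open>i \<le> n\<close> \<open>x \<in> {c..d}\<close>
proof (induction i arbitrary: x rule: inc_induct)
  case base
  then show ?case
    using assms(3) by simp
next
  case (step i)
  obtain z where z: "z \<in> {c..d}" "w i z = 0"
    using zero step.hyps by blast
  have B: "0 \<le> B * (d - c) ^ (n - Suc i)"
    using step.IH[OF step.prems] by linarith
  have "norm (w i x - w i z) \<le> B * (d - c) ^ (n - Suc i) * norm (x - z)"
    by (rule field_differentiable_bound[of "{c..d}" "w i" "w (Suc i)"])
      (use assms(1) step z in auto)
  also have "\<dots> \<le> B * (d - c) ^ (n - Suc i) * (d - c)"
    using step.prems z by (intro mult_left_mono B) auto
  also have "\<dots> = B * (d - c) ^ (n - i)"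
    using step.hyps by (simp add: Suc_diff_Suc power_Suc2 flip: power_Suc2)
  finally show ?case
    using z by simp
qed

lemma integral_square_perturbation:
  fixes f g :: "real \<Rightarrow> real"
  assumes "c \<le> d" "continuous_on {c..d} f" "continuous_on {c..d} g"
    and "\<And>x. x \<in> {c..d} \<Longrightarrow> \<bar>f x - g x\<bar> \<le> \<epsilon>" "\<And>x. x \<in> {c..d} \<Longrightarrow> \<bar>g x\<bar> \<le> G"
  shows "\<bar>integral {c..d} (\<lambda>x. (f x)\<^sup>2) - integral {c..d} (\<lambda>x. (g x)\<^sup>2)\<bar> \<le> (d - c) * (2 * G * \<epsilon> + \<epsilon>\<^sup>2)"
proof -
  have i: "(\<lambda>x. (f x)\<^sup>2) integrable_on {c..d}" "(\<lambda>x. (g x)\<^sup>2) integrable_on {c..d}"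
    using assms by (auto intro!: integrable_continuous_real continuous_intros)
  have "norm (integral {c..d} (\<lambda>x. (f x)\<^sup>2 - (g x)\<^sup>2)) \<le> (2 * G * \<epsilon> + \<epsilon>\<^sup>2) * (d - c)"
  proof (rule integral_bound[OF assms(1)])
    show "continuous_on {c..d} (\<lambda>x. (f x)\<^sup>2 - (g x)\<^sup>2)"
      using assms by (intro continuous_intros)
    fix x assume "x \<in> {c..d}"
    then have x: "\<bar>f x - g x\<bar> \<le> \<epsilon>" "\<bar>g x\<bar> \<le> G"
      using assms by auto
    have "\<bar>(f x)\<^sup>2 - (g x)\<^sup>2\<bar> = \<bar>(f x - g x) * (2 * g x + (f x - g x))\<bar>"
      by (simp add: power2_eq_square algebra_simps)
    also have "\<dots> \<le> \<epsilon> * (2 * G + \<epsilon>)"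
      unfolding abs_mult using x by (intro mult_mono) auto
    finally show "norm ((f x)\<^sup>2 - (g x)\<^sup>2) \<le> 2 * G * \<epsilon> + \<epsilon>\<^sup>2"
      by (simp add: power2_eq_square algebra_simps)
  qed
  then show ?thesis
    using i by (simp add: Henstock_Kurzweil_Integration.integral_diff mult.commute)
qed

lemma integral_rescale:
  fixes f :: "real \<Rightarrow> real"
  assumes "0 < q" "continuous_on {-1..1} f"
  shows "integral {\<mu> - q..\<mu> + q} (\<lambda>x. f ((x - \<mu>) / q)) = q * integral {-1..1} f"
proof -
  have "((\<lambda>x. (1 / q) *\<^sub>R f ((x - \<mu>) / q)) has_integral
      integral {(\<mu> - q - \<mu>) / q..(\<mu> + q - \<mu>) / q} f) {\<mu> - q..\<mu> + q}"
    using assms by (intro has_integral_substitution[where c = "-1" and d = 1])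
      (auto intro!: derivative_eq_intros simp: field_simps)
  then have "((\<lambda>x. q * ((1 / q) * f ((x - \<mu>) / q))) has_integral q * integral {-1..1} f) {\<mu> - q..\<mu> + q}"
    using assms(1) by (intro has_integral_mult_right) simp
  then show ?thesis
    using assms(1) by (simp add: integral_unique)
qed

section \<open>Local error expansion of the Hermite-Jacobi interpolant\<close>

locale interpolation_setting =
  fixes a b :: real and u :: "real \<Rightarrow> real" and p m :: nat
  assumes ab: "a < b" and Ck: "Ck_on (p + 2) {a..b} u" and pm: "2 * m + 1 \<le> p"
begin

abbreviation D :: "nat \<Rightarrow> real \<Rightarrow> real" where
  "D i \<equiv> nth_deriv_within {a..b} i u"

lemma D_deriv:
  assumes "i < p + 2" "x \<in> {a..b}"
  shows "(D i has_real_derivative D (Suc i) x) (at x within {a..b})"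
  using assms Ck
  by (auto simp: Ck_on_def has_real_derivative_iff_has_vector_derivative simp flip: vector_derivative_works)

lemma D_cont: "i \<le> p + 2 \<Longrightarrow> continuous_on {a..b} (D i)"
proof (cases "i = p + 2")
  case True
  then show ?thesis
    using Ck by (simp add: Ck_on_def)
next
  case False
  assume "i \<le> p + 2"
  with False show ?thesis
    using D_deriv[of i] by (intro DERIV_continuous_on) auto
qed

lemma D_bound:
  assumes "i \<le> p + 2"
  obtains B where "0 < B" "\<And>x. x \<in> {a..b} \<Longrightarrow> \<bar>D i x\<bar> \<le> B"
proof -
  have "bounded (D i ` {a..b})"
    using D_cont[OF assms] by (intro compact_imp_bounded compact_continuous_image) auto
  then show ?thesis
    using that unfolding bounded_pos by (metis imageI real_norm_def)
qed

definition interpolates :: "real \<Rightarrow> real \<Rightarrow> real poly \<Rightarrow> bool" where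
  "interpolates c d P \<longleftrightarrow> a \<le> c \<and> c < d \<and> d \<le> b \<and> degree P \<le> p \<and>
     (\<forall>i\<le>m. \<forall>x\<in>{c, d}. poly ((pderiv ^^ i) P) x = D i x) \<and>
     (\<forall>\<mu>. poly (HJ_poly (int m) (p - 2 * m - 1)) \<mu> = 0 \<longrightarrow>
       poly P ((c + d) / 2 + (d - c) * \<mu> / 2) = u ((c + d) / 2 + (d - c) * \<mu> / 2))"

text \<open>The derivative of order \<open>i\<close> of the interpolation error of the Taylor term
  of degree \<open>p + 1\<close> at the midpoint; each differentiation of the rescaled
  \<open>HJ_remainder\<close> divides by the half length.\<close>

definition main_part :: "real \<Rightarrow> real \<Rightarrow> nat \<Rightarrow> real \<Rightarrow> real" where
  "main_part c d i x = D (p + 1) ((c + d) / 2) / fact (p + 1) *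
     (((d - c) / 2) ^ (p + 1 - i) * poly ((pderiv ^^ i) (HJ_remainder p m)) ((x - (c + d) / 2) / ((d - c) / 2)))"

text \<open>The difference \<open>w\<close> of the error and its main part has at least \<open>p + 1\<close> zeros, counted with
  multiplicity, so by Rolle each of its derivatives of order at most \<open>p\<close> has a zero. Hence all
  of them are bounded by integrating the derivative of order \<open>p + 1\<close>, which is
  \<open>u\<^sup>(\<^sup>p\<^sup>+\<^sup>1\<^sup>) - u\<^sup>(\<^sup>p\<^sup>+\<^sup>1\<^sup>)(m\<^sub>j) = O(h)\<close>.\<close>

lemma pointwise_error:
  assumes P: "interpolates c d P" and M: "\<And>x. x \<in> {a..b} \<Longrightarrow> \<bar>D (p + 2) x\<bar> \<le> M"
    and "i \<le> p + 1" "x \<in> {c..d}"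
  shows "\<bar>D i x - poly ((pderiv ^^ i) P) x - main_part c d i x\<bar> \<le> M * (d - c) ^ (p + 2 - i)"
proof -
  define \<mu> where "\<mu> = (c + d) / 2"
  define q where "q = (d - c) / 2"
  have cd: "a \<le> c" "c < d" "d \<le> b" and degP: "degree P \<le> p"
    using P by (auto simp: interpolates_def)
  have q: "q > 0" "\<mu> - q = c" "\<mu> + q = d"
    using cd by (auto simp: q_def \<mu>_def field_simps)
  define w where "w = (\<lambda>i x. D i x - poly ((pderiv ^^ i) P) x - main_part c d i x)"
  have sub: "x \<in> {c..d} \<Longrightarrow> x \<in> {a..b}" for x
    using cd by auto
  have main: "main_part c d i x = D (p + 1) \<mu> / fact (p + 1) * (q ^ (p + 1 - i) * poly ((pderiv ^^ i) (HJ_remainder p m)) ((x - \<mu>) / q))" for i x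
    by (simp only: main_part_def \<mu>_def q_def)
  have dmain: "(main_part c d i has_real_derivative main_part c d (Suc i) x) (at x within T)" if "i < p + 1" for i x T
  proof -
    have "((\<lambda>x. poly ((pderiv ^^ i) (HJ_remainder p m)) ((x - \<mu>) / q)) has_real_derivative
        poly (pderiv ((pderiv ^^ i) (HJ_remainder p m))) ((x - \<mu>) / q) * (1 / q)) (at x within T)"
      using q by (intro DERIV_chain2[OF poly_DERIV]) (auto intro!: derivative_eq_intros)
    then have "((\<lambda>x. D (p + 1) \<mu> / fact (p + 1) * (q ^ (p + 1 - i) * poly ((pderiv ^^ i) (HJ_remainder p m)) ((x - \<mu>) / q)))
      has_real_derivative D (p + 1) \<mu> / fact (p + 1) * (q ^ (p + 1 - i) *
        (poly (pderiv ((pderiv ^^ i) (HJ_remainder p m))) ((x - \<mu>) / q) * (1 / q)))) (at x within T)"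
      by (intro DERIV_cmult)
    moreover have "q ^ (p + 1 - i) = q * q ^ (p + 1 - Suc i)"
      using that by (simp add: Suc_diff_le flip: power_Suc)
    ultimately show ?thesis
      using q by (simp add: main[abs_def])
  qed
  have dw: "(w i has_real_derivative w (Suc i) x) (at x within {c..d})" if "i < p + 1" "x \<in> {c..d}" for i x
  proof -
    have "(D i has_real_derivative D (Suc i) x) (at x within {c..d})"
      using D_deriv[of i x] that sub by (auto intro: DERIV_subset)
    moreover have "(poly ((pderiv ^^ i) P) has_real_derivative poly ((pderiv ^^ Suc i) P) x) (at x within {c..d})"
      using has_field_derivative_at_within[OF poly_DERIV] by simp
    ultimately show ?thesis
      unfolding w_def using dmain[OF that(1)] by (intro DERIV_diff)
  qed
  have ends: "w i c = 0" "w i d = 0" if "i < m + 1" for i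
  proof -
    have "(c - \<mu>) / q = -1" "(d - \<mu>) / q = 1"
      using q by (auto simp: field_simps)
    then show "w i c = 0" "w i d = 0"
      using that P HJ_remainder_endpoint[OF pm, of i "-1"] HJ_remainder_endpoint[OF pm, of i 1]
      by (auto simp: w_def main interpolates_def)
  qed
  obtain Z where Z: "finite Z" "Z \<subseteq> {-1<..<1}" "card Z = p - 2 * m - 1"
    "\<And>z. z \<in> Z \<Longrightarrow> poly (HJ_poly (int m) (p - 2 * m - 1)) z = 0 \<and> poly (HJ_remainder p m) z = 0"
    using HJ_roots[OF pm] by blast
  define Y where "Y = (\<lambda>z. \<mu> + q * z) ` Z"
  have Y: "finite Y" "Y \<subseteq> {c<..<d}" "card Y = p - 2 * m - 1"
  proof -
    show "card Y = p - 2 * m - 1"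
      unfolding Y_def using q Z by (subst card_image) (auto simp: inj_on_def)
    show "Y \<subseteq> {c<..<d}"
    proof
      fix y assume "y \<in> Y"
      then obtain z where z: "z \<in> {-1<..<1}" "y = \<mu> + q * z"
        using Z by (auto simp: Y_def)
      then have "q * (-1) < q * z" "q * z < q * 1"
        using q(1) by (intro mult_strict_left_mono; simp)+
      then show "y \<in> {c<..<d}"
        using q z by auto
    qed
  qed (use Z in \<open>simp add: Y_def\<close>)
  have zY: "w 0 y = 0" if y: "y \<in> Y" for y
  proof -
    obtain z where z: "z \<in> Z" "y = \<mu> + q * z"
      using y by (auto simp: Y_def)
    then have "(y - \<mu>) / q = z" "y = (c + d) / 2 + (d - c) * z / 2"
      using q by (auto simp: \<mu>_def q_def)
    then show ?thesis
      using Z(4)[OF z(1)] P by (simp add: w_def main interpolates_def)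
  qed
  \<comment> \<open>For orders from 1 to \<open>p\<close> the zero count of Rolle is positive. At
    order 0 there is no interior zero to rely on if \<open>p = 2 * m + 1\<close>, and an endpoint
    serves instead.\<close>
  have zero: "\<exists>z\<in>{c..d}. w i z = 0" if "i < p + 1" for i
  proof (cases "i = 0")
    case True
    then show ?thesis
      using ends[of 0] cd by auto
  next
    case False
    have "\<exists>Z'. finite Z' \<and> Z' \<subseteq> {c<..<d} \<and> (\<forall>z\<in>Z'. w i z = 0) \<and>
      card Z' = (if i \<le> m + 1 then (p - 2 * m - 1) + i else (p - 2 * m - 1) + 2 * (m + 1) - i)"
    proof (rule Rolle_iterated[of _ _ "p + 1" w "m + 1" Y])
      show "continuous_on {c..d} (w i)" if "i < p + 1" for i
        using dw[OF that] by (intro DERIV_continuous_on)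
      show "(w i has_real_derivative w (Suc i) x) (at x)" if "i < p + 1" "x \<in> {c<..<d}" for i x
        using dw[OF that(1), of x] that(2) at_within_Icc_at[of c x d] by auto
    qed (use cd ends Y zY \<open>i < p + 1\<close> in auto)
    then obtain Z' where Z': "Z' \<subseteq> {c<..<d}" "\<forall>z\<in>Z'. w i z = 0"
      "card Z' = (if i \<le> m + 1 then (p - 2 * m - 1) + i else (p - 2 * m - 1) + 2 * (m + 1) - i)"
      by blast
    have "card Z' > 0"
      unfolding Z'(3) using False that pm by auto
    then obtain z where "z \<in> Z'"
      by fastforce
    then show ?thesis
      using Z' by (intro bexI[of _ z]) auto
  qed
  have top: "\<bar>w (p + 1) x\<bar> \<le> M * (d - c)" if "x \<in> {c..d}" for x
  proof -
    have "w (p + 1) x = D (p + 1) x - D (p + 1) \<mu>"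
      using degP HJ_remainder_monic[OF pm] by (simp add: w_def main higher_pderiv_degree_less del: funpow.simps fact_Suc)
    moreover have "norm (D (p + 1) x - D (p + 1) \<mu>) \<le> M * norm (x - \<mu>)"
      using cd that M D_deriv[of "p + 1"]
      by (intro field_differentiable_bound[of "{a..b}" _ "D (p + 2)"]) (auto simp: \<mu>_def)
    moreover have "M * norm (x - \<mu>) \<le> M * (d - c)"
      using that M[of x] sub[OF that] q by (intro mult_left_mono) (auto simp: \<mu>_def)
    ultimately show ?thesis
      by simp
  qed
  have "\<bar>w i x\<bar> \<le> M * (d - c) * (d - c) ^ (p + 1 - i)"
    by (rule derivative_bound_from_zeros[of "p + 1"]) (use dw zero top assms in auto)
  also have "\<dots> = M * (d - c) ^ (p + 2 - i)"
    using \<open>i \<le> p + 1\<close> by (simp add: Suc_diff_le)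
  finally show ?thesis
    by (simp add: w_def)
qed

text \<open>The sharp estimate serves the order \<open>k\<close> of the norm; the crude one serves
  the orders below \<open>k\<close>, where the whole squared error is absorbed into the
  remainder.\<close>

lemma local_error:
  assumes "i \<le> p + 1"
  obtains K where "0 \<le> K" "\<And>c d P. interpolates c d P \<Longrightarrow>
    \<bar>integral {c..d} (\<lambda>x. (D i x - poly ((pderiv ^^ i) P) x)\<^sup>2) -
       ((d - c) / 2) ^ (2 * p + 3 - 2 * i) * (D (p + 1) ((c + d) / 2) / fact (p + 1))\<^sup>2 *
        integral {-1..1} (\<lambda>t. (poly ((pderiv ^^ i) (HJ_remainder p m)) t)\<^sup>2)\<bar> \<le> K * (d - c) ^ (2 * p + 4 - 2 * i)"
    "\<And>c d P. interpolates c d P \<Longrightarrow>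
      integral {c..d} (\<lambda>x. (D i x - poly ((pderiv ^^ i) P) x)\<^sup>2) \<le> K * (d - c) ^ (2 * p + 3 - 2 * i)"
proof -
  define \<Phi> where "\<Phi> = (pderiv ^^ i) (HJ_remainder p m)"
  define I where "I = integral {-1..1} (\<lambda>t. (poly \<Phi> t)\<^sup>2)"
  have I: "0 \<le> I"
    unfolding I_def by (intro integral_nonneg integrable_continuous_real continuous_intros) auto
  obtain M1 where M1: "0 < M1" "\<And>x. x \<in> {a..b} \<Longrightarrow> \<bar>D (p + 1) x\<bar> \<le> M1"
    using D_bound[of "p + 1"] by auto
  obtain M2 where M2: "0 < M2" "\<And>x. x \<in> {a..b} \<Longrightarrow> \<bar>D (p + 2) x\<bar> \<le> M2"
    using D_bound[of "p + 2"] by auto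
  have "bounded (poly \<Phi> ` {-1..1})"
    by (intro compact_imp_bounded compact_continuous_image continuous_intros) auto
  then obtain B where B: "0 < B" "\<And>x. x \<in> {-1..1} \<Longrightarrow> \<bar>poly \<Phi> x\<bar> \<le> B"
    unfolding bounded_pos by (metis imageI real_norm_def)
  \<comment> \<open>\<open>K1\<close> collects the cross term and the square of the correction,
    whose surplus power of the length is bounded by \<open>b - a\<close>. \<open>K\<close> adds the
    size of the main part for the crude estimate.\<close>
  define K1 where "K1 = 2 * M1 * B * M2 + M2\<^sup>2 * (b - a)"
  define K where "K = K1 * (1 + (b - a)) + M1\<^sup>2 * I"
  have K1: "0 \<le> K1"
    using M1 M2 B ab by (simp add: K1_def)
  have K: "K1 \<le> K" "0 \<le> K" "K1 * (b - a) + M1\<^sup>2 * I \<le> K"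
  proof -
    have "0 \<le> K1 * (b - a)" "0 \<le> M1\<^sup>2 * I"
      using K1 I ab by auto
    then show "K1 \<le> K" "0 \<le> K" "K1 * (b - a) + M1\<^sup>2 * I \<le> K"
      using K1 by (simp_all add: K_def distrib_left)
  qed
  have est: "\<bar>integral {c..d} (\<lambda>x. (D i x - poly ((pderiv ^^ i) P) x)\<^sup>2) -
       ((d - c) / 2) ^ (2 * p + 3 - 2 * i) * (D (p + 1) ((c + d) / 2) / fact (p + 1))\<^sup>2 * I\<bar>
      \<le> K1 * (d - c) ^ (2 * p + 4 - 2 * i)" (is "\<bar>?A - ?B\<bar> \<le> _")
    and C: "\<bar>D (p + 1) ((c + d) / 2) / fact (p + 1)\<bar> \<le> M1" if P: "interpolates c d P" for c d P
  proof -
    define \<mu> where "\<mu> = (c + d) / 2"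
    define q where "q = (d - c) / 2"
    define h where "h = d - c"
    define C where "C = D (p + 1) \<mu> / fact (p + 1)"
    have cd: "a \<le> c" "c < d" "d \<le> b" "0 < h" "h \<le> b - a"
      using P by (auto simp: interpolates_def h_def)
    have q: "q > 0" "\<mu> - q = c" "\<mu> + q = d" "q \<le> h"
      using cd by (auto simp: q_def \<mu>_def h_def field_simps)
    have "\<mu> \<in> {a..b}"
      using cd by (auto simp: \<mu>_def)
    then have "\<bar>D (p + 1) \<mu>\<bar> \<le> M1"
      by (rule M1)
    moreover have "\<bar>C\<bar> \<le> \<bar>D (p + 1) \<mu>\<bar>"
      using fact_ge_1[of "p + 1", where 'a = real] by (simp add: C_def abs_divide divide_le_eq mult_le_cancel_left1 del: fact_Suc nth_deriv_within.simps(2))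
    ultimately show C: "\<bar>D (p + 1) ((c + d) / 2) / fact (p + 1)\<bar> \<le> M1"
      unfolding C_def \<mu>_def by linarith
    have CM: "\<bar>C\<bar> \<le> M1"
      using C unfolding C_def \<mu>_def .
    have main: "main_part c d i x = C * (q ^ (p + 1 - i) * poly \<Phi> ((x - \<mu>) / q))" for x
      by (simp only: main_part_def C_def \<mu>_def q_def \<Phi>_def)
    have "\<bar>?A - integral {c..d} (\<lambda>x. (main_part c d i x)\<^sup>2)\<bar> \<le>
      (d - c) * (2 * (M1 * (h ^ (p + 1 - i) * B)) * (M2 * h ^ (p + 2 - i)) + (M2 * h ^ (p + 2 - i))\<^sup>2)"
    proof (rule integral_square_perturbation)
      show "continuous_on {c..d} (\<lambda>x. D i x - poly ((pderiv ^^ i) P) x)"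
        using D_cont[of i] assms cd by (intro continuous_intros) (auto intro: continuous_on_subset)
      show "continuous_on {c..d} (main_part c d i)"
        unfolding main[abs_def] using q by (intro continuous_intros) auto
      show "\<bar>D i x - poly ((pderiv ^^ i) P) x - main_part c d i x\<bar> \<le> M2 * h ^ (p + 2 - i)" if "x \<in> {c..d}" for x
        unfolding h_def by (rule pointwise_error) (use P M2 assms that in auto)
      show "\<bar>main_part c d i x\<bar> \<le> M1 * (h ^ (p + 1 - i) * B)" if "x \<in> {c..d}" for x
      proof -
        have "(x - \<mu>) / q \<in> {-1..1}"
          using that q by (auto simp: field_simps)
        then show ?thesis
          unfolding main abs_mult using CM B q M1
          by (intro mult_mono) (auto intro!: power_mono)
      qed
    qed (use cd in auto)
    also have "\<dots> = 2 * M1 * B * M2 * (h * h ^ (p + 1 - i) * h ^ (p + 2 - i)) + M2\<^sup>2 * (h * (h ^ (p + 2 - i))\<^sup>2)"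
      by (simp add: h_def power2_eq_square algebra_simps)
    also have "h * h ^ (p + 1 - i) * h ^ (p + 2 - i) = h ^ (2 * p + 4 - 2 * i)"
    proof -
      have "1 + (p + 1 - i) + (p + 2 - i) = 2 * p + 4 - 2 * i"
        using assms by simp
      then show ?thesis
        by (metis power_add power_one_right)
    qed
    also have "h * (h ^ (p + 2 - i))\<^sup>2 = h * h ^ (2 * p + 4 - 2 * i)"
    proof -
      have "(p + 2 - i) * 2 = 2 * p + 4 - 2 * i"
        by simp
      then show ?thesis
        by (metis power_mult)
    qed
    also have "2 * M1 * B * M2 * h ^ (2 * p + 4 - 2 * i) + M2\<^sup>2 * (h * h ^ (2 * p + 4 - 2 * i)) \<le>
        2 * M1 * B * M2 * h ^ (2 * p + 4 - 2 * i) + M2\<^sup>2 * ((b - a) * h ^ (2 * p + 4 - 2 * i))"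
      using cd by (intro add_left_mono mult_left_mono mult_right_mono) auto
    also have "\<dots> = K1 * h ^ (2 * p + 4 - 2 * i)"
      by (simp add: K1_def algebra_simps)
    also have "integral {c..d} (\<lambda>x. (main_part c d i x)\<^sup>2) = ?B"
    proof -
      have "integral {c..d} (\<lambda>x. (main_part c d i x)\<^sup>2) =
        integral {\<mu> - q..\<mu> + q} (\<lambda>x. (C * q ^ (p + 1 - i))\<^sup>2 * (poly \<Phi> ((x - \<mu>) / q))\<^sup>2)"
        unfolding q by (simp add: main power_mult_distrib mult.assoc)
      also have "\<dots> = (C * q ^ (p + 1 - i))\<^sup>2 * (q * I)"
        unfolding integral_mult_right I_def
        by (subst integral_rescale[OF q(1), of "\<lambda>t. (poly \<Phi> t)\<^sup>2"]) (auto intro!: continuous_intros)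
      also have "\<dots> = C\<^sup>2 * (q * (q ^ (p + 1 - i))\<^sup>2) * I"
        by (simp add: power_mult_distrib)
      also have "q * (q ^ (p + 1 - i))\<^sup>2 = q ^ (2 * p + 3 - 2 * i)"
      proof -
        have "1 + (p + 1 - i) * 2 = 2 * p + 3 - 2 * i"
          using assms by simp
        then show ?thesis
          by (metis power_add power_mult power_one_right)
      qed
      finally show ?thesis
        by (simp add: C_def \<mu>_def q_def mult.commute)
    qed
    finally show "\<bar>?A - ?B\<bar> \<le> K1 * (d - c) ^ (2 * p + 4 - 2 * i)"
      by (simp add: h_def)
  qed
  show ?thesis
  proof (rule that[of K])
    fix c d P assume P: "interpolates c d P"
    have cd: "0 < d - c" "d - c \<le> b - a"
      using P by (auto simp: interpolates_def)
    have "K1 * (d - c) ^ (2 * p + 4 - 2 * i) \<le> K * (d - c) ^ (2 * p + 4 - 2 * i)"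
      using K cd by (intro mult_right_mono) auto
    then show "\<bar>integral {c..d} (\<lambda>x. (D i x - poly ((pderiv ^^ i) P) x)\<^sup>2) -
       ((d - c) / 2) ^ (2 * p + 3 - 2 * i) * (D (p + 1) ((c + d) / 2) / fact (p + 1))\<^sup>2 *
        integral {-1..1} (\<lambda>t. (poly ((pderiv ^^ i) (HJ_remainder p m)) t)\<^sup>2)\<bar> \<le> K * (d - c) ^ (2 * p + 4 - 2 * i)"
      using est[OF P] unfolding I_def \<Phi>_def by linarith
    have "(D (p + 1) ((c + d) / 2) / fact (p + 1))\<^sup>2 \<le> M1\<^sup>2"
      using C[OF P] M1(1) by (metis abs_le_square_iff abs_of_pos)
    moreover have "((d - c) / 2) ^ (2 * p + 3 - 2 * i) \<le> (d - c) ^ (2 * p + 3 - 2 * i)"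
      using cd by (intro power_mono) auto
    ultimately have "((d - c) / 2) ^ (2 * p + 3 - 2 * i) * (D (p + 1) ((c + d) / 2) / fact (p + 1))\<^sup>2 * I
      \<le> (d - c) ^ (2 * p + 3 - 2 * i) * M1\<^sup>2 * I"
      using cd I by (intro mult_right_mono[OF mult_mono]) auto
    also have "\<dots> = M1\<^sup>2 * I * (d - c) ^ (2 * p + 3 - 2 * i)"
      by simp
    finally have "((d - c) / 2) ^ (2 * p + 3 - 2 * i) * (D (p + 1) ((c + d) / 2) / fact (p + 1))\<^sup>2 * I
      \<le> M1\<^sup>2 * I * (d - c) ^ (2 * p + 3 - 2 * i)" .
    moreover have "K1 * (d - c) ^ (2 * p + 4 - 2 * i) \<le> K1 * (b - a) * (d - c) ^ (2 * p + 3 - 2 * i)"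
    proof -
      have "2 * p + 4 - 2 * i = Suc (2 * p + 3 - 2 * i)"
        using assms by simp
      then show ?thesis
        using cd K1 by (simp add: mult.assoc mult_left_mono mult_right_mono)
    qed
    moreover have "(K1 * (b - a) + M1\<^sup>2 * I) * (d - c) ^ (2 * p + 3 - 2 * i) \<le> K * (d - c) ^ (2 * p + 3 - 2 * i)"
      using K cd by (intro mult_right_mono) auto
    ultimately show "integral {c..d} (\<lambda>x. (D i x - poly ((pderiv ^^ i) P) x)\<^sup>2) \<le> K * (d - c) ^ (2 * p + 3 - 2 * i)"
      using est[OF P] unfolding distrib_right by linarith
  qed (rule K)
qed

end

section \<open>Summation over a partition\<close>

lemma partition_nodes:
  assumes "is_partition a b xs"
  shows "1 \<le> num_elems xs" "xs ! 0 = a" "xs ! num_elems xs = b"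
    "i < j \<Longrightarrow> j \<le> num_elems xs \<Longrightarrow> xs ! i < xs ! j"
proof -
  have ne: "xs \<noteq> []"
    using assms by (auto simp: is_partition_def)
  show "1 \<le> num_elems xs" "xs ! 0 = a" "xs ! num_elems xs = b"
    using assms ne by (auto simp: is_partition_def num_elems_def hd_conv_nth last_conv_nth)
  show "i < j \<Longrightarrow> j \<le> num_elems xs \<Longrightarrow> xs ! i < xs ! j"
    using assms by (auto simp: is_partition_def num_elems_def sorted_wrt_iff_nth_less)
qed

lemma partition_nodes_le:
  assumes "is_partition a b xs" "i \<le> j" "j \<le> num_elems xs"
  shows "xs ! i \<le> xs ! j"
  using assms partition_nodes(4)[OF assms(1), of i j] by (cases "i = j") auto

lemma sum_elem_len: "(\<Sum>j = 1..n. elem_len xs j) = xs ! n - xs ! 0"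
  by (induction n) (auto simp: elem_len_def)

lemma sum_elem_len_partition: "is_partition a b xs \<Longrightarrow> (\<Sum>j = 1..num_elems xs. elem_len xs j) = b - a"
  by (simp only: sum_elem_len partition_nodes)

lemma elem_len_mesh:
  assumes "is_partition a b xs" "j \<in> {1..num_elems xs}"
  shows "0 < elem_len xs j" "elem_len xs j \<le> mesh xs" "mesh xs \<le> b - a"
proof -
  have pos: "0 < elem_len xs j" if "j \<in> {1..num_elems xs}" for j
    using partition_nodes(4)[OF assms(1), of "j - 1" j] that by (simp add: elem_len_def)
  then show "0 < elem_len xs j"
    using assms(2) by blast
  show "elem_len xs j \<le> mesh xs"
    using assms(2) by (auto simp: mesh_def)
  have "elem_len xs i \<le> b - a" if "i \<in> {1..num_elems xs}" for i
    unfolding sum_elem_len_partition[OF assms(1), symmetric]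
    by (rule member_le_sum) (use that pos in \<open>auto intro: less_imp_le\<close>)
  then show "mesh xs \<le> b - a"
    using assms(2) by (auto simp: mesh_def)
qed

lemma integral_partition:
  fixes f :: "real \<Rightarrow> real"
  assumes "is_partition a b xs" "f integrable_on {a..b}"
  shows "integral {a..b} f = (\<Sum>j = 1..num_elems xs. integral {xs ! (j - 1)..xs ! j} f)"
proof -
  have "integral {xs ! 0..xs ! n} f = (\<Sum>j = 1..n. integral {xs ! (j - 1)..xs ! j} f)" if "n \<le> num_elems xs" for n
    using that
  proof (induction n)
    case (Suc n)
    have le: "xs ! 0 \<le> xs ! n" "xs ! n \<le> xs ! Suc n" "xs ! Suc n \<le> xs ! num_elems xs"
      using Suc.prems by (auto intro!: partition_nodes_le[OF assms(1)])
    have "f integrable_on {xs ! 0..xs ! Suc n}"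
      using integrable_on_subinterval[OF assms(2), of "xs ! 0" "xs ! Suc n"] le partition_nodes[OF assms(1)]
      by auto
    then have "integral {xs ! 0..xs ! Suc n} f = integral {xs ! 0..xs ! n} f + integral {xs ! n..xs ! Suc n} f"
      using Henstock_Kurzweil_Integration.integral_combine[OF le(1,2)] by metis
    then show ?case
      using Suc by simp
  qed simp
  from this[of "num_elems xs"] show ?thesis
    using partition_nodes(2,3)[OF assms(1)] by simp
qed

section \<open>The global error as a sum over the elements\<close>

context interpolation_setting
begin

lemma D_deriv_at:
  assumes "i < p + 2" "a < x" "x < b"
  shows "(D i has_real_derivative D (Suc i) x) (at x)"
  using D_deriv[of i x] at_within_Icc_at[of a x b] assms by auto

lemma sobolev_norm_D:
  assumes "k \<le> p + 2"
  shows "(sobolev_norm k a b u)\<^sup>2 = (\<Sum>i\<le>k. integral {a..b} (\<lambda>x. (D i x)\<^sup>2))"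
proof -
  interpret piecewise_derivatives a b k "{}" D
  proof
    show "bounded (D k ` {a<..<b})"
      using D_cont[OF assms]
      by (intro bounded_subset[OF compact_imp_bounded[OF compact_continuous_image[of "{a..b}"]]]) auto
    show "continuous_on ({a<..<b} - {}) (D k)"
      using D_cont[OF assms] by (auto intro: continuous_on_subset)
  qed (use ab D_cont D_deriv_at assms in auto)
  show ?thesis
    by (rule sobolev_norm_square) simp
qed

text \<open>Neighbouring polynomials match at a node up to order \<open>m\<close>. As
  \<open>k \<le> m + 1\<close>, the derivative of order \<open>k\<close> is the only one among those
  needed that can jump, which is what \<open>piecewise_derivatives\<close> admits.\<close>

lemma sobolev_norm_error:
  assumes part: "is_partition a b xs" and W: "is_HJ_interpolant p m a b u xs W" and k: "k \<le> m + 1"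
  obtains P where "\<And>j. j \<in> {1..num_elems xs} \<Longrightarrow> interpolates (xs ! (j - 1)) (xs ! j) (P j)"
    "(sobolev_norm k a b (\<lambda>x. u x - W x))\<^sup>2 = (\<Sum>i\<le>k. \<Sum>j = 1..num_elems xs.
      integral {xs ! (j - 1)..xs ! j} (\<lambda>x. (D i x - poly ((pderiv ^^ i) (P j)) x)\<^sup>2))"
proof -
  define N where "N = num_elems xs"
  have nodes: "1 \<le> N" "xs ! 0 = a" "xs ! N = b" "\<And>i j. i < j \<Longrightarrow> j \<le> N \<Longrightarrow> xs ! i < xs ! j"
    "\<And>i j. i \<le> j \<Longrightarrow> j \<le> N \<Longrightarrow> xs ! i \<le> xs ! j"
    using partition_nodes[OF part] partition_nodes_le[OF part] by (auto simp: N_def)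
  have ends: "a \<le> xs ! (j - 1)" "xs ! (j - 1) < xs ! j" "xs ! j \<le> b" if "j \<in> {1..N}" for j
    using nodes(2,3) nodes(4)[of "j - 1" j] nodes(5)[of 0 "j - 1"] nodes(5)[of j N] that by auto
  obtain P where P: "\<And>j. j \<in> {1..N} \<Longrightarrow> degree (P j) \<le> p \<and>
        (\<forall>x\<in>{xs ! (j - 1)..xs ! j}. W x = poly (P j) x) \<and>
        (\<forall>i\<le>m. \<forall>x\<in>{xs ! (j - 1), xs ! j}. poly ((pderiv ^^ i) (P j)) x = D i x) \<and>
        (\<forall>\<mu>. poly (HJ_poly (int m) (p - 2 * m - 1)) \<mu> = 0 \<longrightarrow>
           poly (P j) (elem_mid xs j + elem_len xs j * \<mu> / 2) = u (elem_mid xs j + elem_len xs j * \<mu> / 2))"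
    using W unfolding is_HJ_interpolant_def N_def[symmetric] by metis
  have Pi: "interpolates (xs ! (j - 1)) (xs ! j) (P j)" if "j \<in> {1..N}" for j
    using P[OF that] ends[OF that] unfolding interpolates_def elem_mid_def elem_len_def by blast
  \<comment> \<open>At an inner node \<open>idx\<close> picks the element on the left; by the matching conditions this
    choice does not affect \<open>V i\<close> for \<open>i \<le> m\<close>.\<close>
  define idx where "idx = (\<lambda>x. LEAST j. 1 \<le> j \<and> x \<le> xs ! j)"
  define V where "V = (\<lambda>i x. poly ((pderiv ^^ i) (P (idx x))) x)"
  define F where "F = (\<lambda>i x. D i x - V i x)"
  \<comment> \<open>The left end of the interval lies in none of the half-open elements; the
    alternative \<open>j = 1\<close> assigns it to the first.\<close>
  have idx: "idx x = j" if "j \<in> {1..N}" "x \<le> xs ! j" "xs ! (j - 1) < x \<or> j = 1" for x j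
    unfolding idx_def
  proof (rule Least_equality)
    fix l assume l: "1 \<le> l \<and> x \<le> xs ! l"
    show "j \<le> l"
    proof (rule ccontr)
      assume "\<not> j \<le> l"
      then have "xs ! l \<le> xs ! (j - 1)" "j \<noteq> 1"
        using nodes(5)[of l "j - 1"] that(1) l by auto
      then show False
        using that(3) l by auto
    qed
  qed (use that in auto)
  have V: "V i x = poly ((pderiv ^^ i) (P j)) x"
    if "j \<in> {1..N}" "x \<in> {xs ! (j - 1)..xs ! j}" "i \<le> m \<or> xs ! (j - 1) < x" for i j x
  proof (cases "xs ! (j - 1) < x \<or> j = 1")
    case True
    then show ?thesis
      using idx[of j x] that by (simp add: V_def)
  next
    case False
    then have x: "x = xs ! (j - 1)" "j - 1 \<in> {1..N}" "i \<le> m"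
      using that by auto
    then have "idx x = j - 1"
      using ends[of "j - 1"] by (intro idx) auto
    then show ?thesis
      using P[OF x(2)] P[OF that(1)] x(1,3) by (simp add: V_def)
  qed
  have cover: "\<exists>j\<in>{1..N}. x \<in> {xs ! (j - 1)..xs ! j}" if "x \<in> {a..b}" for x
  proof -
    define j where "j = idx x"
    have ex: "1 \<le> N \<and> x \<le> xs ! N"
      using nodes that by auto
    have j: "1 \<le> j \<and> x \<le> xs ! j" "j \<le> N"
      unfolding j_def idx_def using ex by (rule LeastI, rule Least_le)
    have "xs ! (j - 1) \<le> x"
    proof (cases "j = 1")
      case True
      then show ?thesis
        using nodes that by simp
    next
      case False
      show ?thesis
      proof (rule ccontr)
        assume "\<not> xs ! (j - 1) \<le> x"
        then have "idx x \<le> j - 1"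
          unfolding idx_def using False j by (intro Least_le) auto
        then show False
          using False j(1) unfolding j_def[symmetric] by linarith
      qed
    qed
    then show ?thesis
      using j by auto
  qed
  define S where "S = (\<lambda>j. xs ! j) ` {0..N}"
  have F_deriv: "(F i has_real_derivative F (Suc i) x) (at x)" if ix: "i \<le> k" "x \<in> {a<..<b} - S" for i x
  proof -
    obtain j where j: "j \<in> {1..N}" "x \<in> {xs ! (j - 1)..xs ! j}"
      using cover[of x] ix by auto
    moreover have "x \<noteq> xs ! (j - 1)" "x \<noteq> xs ! j"
      using that j(1) by (auto simp: S_def)
    ultimately have x: "x \<in> {xs ! (j - 1)<..<xs ! j}"
      by auto
    have eq: "F l y = D l y - poly ((pderiv ^^ l) (P j)) y" if "y \<in> {xs ! (j - 1)<..<xs ! j}" for l y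
      unfolding F_def using V[OF j(1), of y l] that by simp
    have "((\<lambda>y. D i y - poly ((pderiv ^^ i) (P j)) y) has_real_derivative
        D (Suc i) x - poly ((pderiv ^^ Suc i) (P j)) x) (at x)"
      using that k pm by (intro DERIV_diff D_deriv_at) auto
    then show ?thesis
      unfolding eq[OF x]
      by (rule has_field_derivative_transform_within_open[of _ _ _ "{xs ! (j - 1)<..<xs ! j}"]) (use x eq in auto)
  qed
  interpret piecewise_derivatives a b k S F
  proof
    show "continuous_on {a..b} (F i)" if "i < k" for i
    proof -
      have "continuous_on (\<Union>j\<in>{1..N}. {xs ! (j - 1)..xs ! j}) (F i)"
      proof (rule continuous_on_closed_Union)
        fix j assume j: "j \<in> {1..N}"
        have "continuous_on {xs ! (j - 1)..xs ! j} (\<lambda>x. D i x - poly ((pderiv ^^ i) (P j)) x)"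
          using D_cont[of i] that k pm ends[OF j] by (intro continuous_intros) (auto intro: continuous_on_subset)
        then show "continuous_on {xs ! (j - 1)..xs ! j} (F i)"
          using V[OF j, of _ i] that k by (subst continuous_on_cong[OF refl]) (auto simp: F_def)
      qed auto
      then show ?thesis
        using cover by (auto elim!: continuous_on_subset)
    qed
    show "continuous_on ({a<..<b} - S) (F k)"
      using F_deriv DERIV_isCont by (intro continuous_at_imp_continuous_on ballI) blast
    obtain B where B: "\<And>x. x \<in> {a..b} \<Longrightarrow> \<bar>D k x\<bar> \<le> B"
      using D_bound[of k] k pm by auto
    have "bounded (\<Union>j\<in>{1..N}. poly ((pderiv ^^ k) (P j)) ` {a..b})"
      by (intro bounded_UN ballI compact_imp_bounded compact_continuous_image continuous_intros) auto
    then obtain C where C: "\<And>j x. j \<in> {1..N} \<Longrightarrow> x \<in> {a..b} \<Longrightarrow> \<bar>poly ((pderiv ^^ k) (P j)) x\<bar> \<le> C"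
      unfolding bounded_iff by (metis UN_I imageI real_norm_def)
    have "\<bar>F k x\<bar> \<le> B + C" if x: "x \<in> {a<..<b}" for x
    proof -
      obtain j where j: "j \<in> {1..N}" "x \<in> {xs ! (j - 1)..xs ! j}"
        using cover[of x] x by auto
      have "\<exists>l\<in>{1..N}. idx x = l"
      proof (cases "xs ! (j - 1) < x \<or> j = 1")
        case True
        then show ?thesis
          using idx[of j x] j by auto
      next
        case False
        then have "j - 1 \<in> {1..N}" "x = xs ! (j - 1)"
          using j by auto
        moreover from this have "idx x = j - 1"
          using ends[of "j - 1"] by (intro idx) auto
        ultimately show ?thesis
          by simp
      qed
      then have "\<bar>V k x\<bar> \<le> C"
        using C[of "idx x" x] that by (auto simp: V_def)
      moreover have "\<bar>D k x\<bar> \<le> B"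
        using B that by auto
      ultimately show ?thesis
        unfolding F_def by linarith
    qed
    then show "bounded (F k ` {a<..<b})"
      unfolding bounded_iff by (intro exI[of _ "B + C"]) auto
  qed (use ab F_deriv in \<open>auto simp: S_def\<close>)
  have "integral {a..b} (\<lambda>x. (F i x)\<^sup>2) = (\<Sum>j = 1..N.
      integral {xs ! (j - 1)..xs ! j} (\<lambda>x. (D i x - poly ((pderiv ^^ i) (P j)) x)\<^sup>2))" if "i \<le> k" for i
  proof -
    have "integral {a..b} (\<lambda>x. (F i x)\<^sup>2) = (\<Sum>j = 1..N. integral {xs ! (j - 1)..xs ! j} (\<lambda>x. (F i x)\<^sup>2))"
      unfolding N_def by (intro integral_partition part square_integrable that)
    also have "\<dots> = (\<Sum>j = 1..N. integral {xs ! (j - 1)..xs ! j} (\<lambda>x. (D i x - poly ((pderiv ^^ i) (P j)) x)\<^sup>2))"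
    proof (rule sum.cong[OF refl])
      fix j assume j: "j \<in> {1..N}"
      \<comment> \<open>If \<open>i = m + 1\<close>, \<open>F i\<close> may take the value of the
        left neighbour at the left node; a single point does not affect the integral.\<close>
      show "integral {xs ! (j - 1)..xs ! j} (\<lambda>x. (F i x)\<^sup>2) =
        integral {xs ! (j - 1)..xs ! j} (\<lambda>x. (D i x - poly ((pderiv ^^ i) (P j)) x)\<^sup>2)"
        by (rule integral_spike[of "{xs ! (j - 1)}"]) (use V[OF j, of _ i] in \<open>auto simp: F_def\<close>)
    qed
    finally show ?thesis .
  qed
  moreover have "u x - W x = F 0 x" if x: "x \<in> {a<..<b}" for x
  proof -
    obtain j where j: "j \<in> {1..N}" "x \<in> {xs ! (j - 1)..xs ! j}"
      using cover[of x] x by auto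
    then show ?thesis
      using V[OF j, of 0] P[OF j(1)] by (simp add: F_def)
  qed
  ultimately have "(sobolev_norm k a b (\<lambda>x. u x - W x))\<^sup>2 = (\<Sum>i\<le>k. \<Sum>j = 1..N.
      integral {xs ! (j - 1)..xs ! j} (\<lambda>x. (D i x - poly ((pderiv ^^ i) (P j)) x)\<^sup>2))"
    using sobolev_norm_square[of "\<lambda>x. u x - W x"] by simp
  then show ?thesis
    using Pi by (intro that[of P]) (auto simp: N_def)
qed

end

text \<open>By \<open>HJ_remainder_norm\<close> this is the squared norm on [-1, 1] of the
  derivative of order \<open>k\<close> of \<open>HJ_remainder\<close>, divided by the square of its
  leading coefficient.\<close>

definition leading_const :: "nat \<Rightarrow> nat \<Rightarrow> nat \<Rightarrow> real" where
  "leading_const p m k = (\<Sum>i\<le>m + 1 - k.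
           (J_hat (int m - int k) (int p - int k + 1) i)\<^sup>2 *
           (J_coeff (-1) (int p - int k + 1 - 2 * int i))\<^sup>2 *
           (2 / (2 * (real p - real k + 1 - 2 * real i) + 1)))"

lemma leading_const_nonneg:
  assumes "2 * m + 1 \<le> p" "k \<le> m + 1"
  shows "0 \<le> leading_const p m k"
  unfolding leading_const_def
proof (intro sum_nonneg mult_nonneg_nonneg zero_le_power2)
  fix i assume "i \<in> {..m + 1 - k}"
  then have "real (i + k) \<le> real (m + 1)"
    using assms by (subst of_nat_le_iff) auto
  moreover have "2 * real m + 1 \<le> real p"
    using assms by linarith
  moreover have "0 \<le> real k"
    by simp
  ultimately show "0 \<le> 2 / (2 * (real p - real k + 1 - 2 * real i) + 1)"
    by (intro divide_nonneg_nonneg) auto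
qed

context interpolation_setting
begin

lemma error_expansion:
  assumes k: "k \<le> m + 1"
  obtains K where "\<And>xs W. is_partition a b xs \<Longrightarrow> is_HJ_interpolant p m a b u xs W \<Longrightarrow>
    \<bar>(sobolev_norm k a b (\<lambda>x. u x - W x))\<^sup>2 - leading_term p m k a b u xs\<bar> \<le> K * mesh xs ^ (2 * p + 3 - 2 * k)"
proof -
  define I where "I = (\<lambda>i. integral {-1..1} (\<lambda>t. (poly ((pderiv ^^ i) (HJ_remainder p m)) t)\<^sup>2))"
  \<comment> \<open>Both local estimates are packed into one predicate so that the constants can be
    chosen as a function of the order.\<close>
  define Q where "Q = (\<lambda>i K. 0 \<le> K \<and> (\<forall>c d P. interpolates c d P \<longrightarrow>
      \<bar>integral {c..d} (\<lambda>x. (D i x - poly ((pderiv ^^ i) P) x)\<^sup>2) -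
        ((d - c) / 2) ^ (2 * p + 3 - 2 * i) * (D (p + 1) ((c + d) / 2) / fact (p + 1))\<^sup>2 * I i\<bar>
          \<le> K * (d - c) ^ (2 * p + 4 - 2 * i) \<and>
      integral {c..d} (\<lambda>x. (D i x - poly ((pderiv ^^ i) P) x)\<^sup>2) \<le> K * (d - c) ^ (2 * p + 3 - 2 * i)))"
  have "\<exists>K. Q i K" if "i \<le> k" for i
  proof -
    have "i \<le> p + 1"
      using that k pm by linarith
    then show ?thesis
      unfolding I_def Q_def by (rule local_error) blast
  qed
  then obtain K where Q: "\<And>i. i \<le> k \<Longrightarrow> Q i (K i)"
    by metis
  have K: "K i \<ge> 0"
    and K1: "interpolates c d P \<Longrightarrow>
      \<bar>integral {c..d} (\<lambda>x. (D i x - poly ((pderiv ^^ i) P) x)\<^sup>2) -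
        ((d - c) / 2) ^ (2 * p + 3 - 2 * i) * (D (p + 1) ((c + d) / 2) / fact (p + 1))\<^sup>2 * I i\<bar>
          \<le> K i * (d - c) ^ (2 * p + 4 - 2 * i)"
    and K2: "interpolates c d P \<Longrightarrow>
      integral {c..d} (\<lambda>x. (D i x - poly ((pderiv ^^ i) P) x)\<^sup>2) \<le> K i * (d - c) ^ (2 * p + 3 - 2 * i)"
    if "i \<le> k" for i c d P
    using Q[OF that] unfolding Q_def by blast+
  show ?thesis
  proof (rule that[of "K k * (b - a) + (\<Sum>i<k. K i * (b - a) ^ (2 * (k - i) - 1) * (b - a))"])
    fix xs W assume part: "is_partition a b xs" and W: "is_HJ_interpolant p m a b u xs W"
    obtain P where P: "\<And>j. j \<in> {1..num_elems xs} \<Longrightarrow> interpolates (xs ! (j - 1)) (xs ! j) (P j)"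
      and norm: "(sobolev_norm k a b (\<lambda>x. u x - W x))\<^sup>2 = (\<Sum>i\<le>k. \<Sum>j = 1..num_elems xs.
        integral {xs ! (j - 1)..xs ! j} (\<lambda>x. (D i x - poly ((pderiv ^^ i) (P j)) x)\<^sup>2))"
      using sobolev_norm_error[OF part W k] by blast
    define N where "N = num_elems xs"
    define H where "H = mesh xs"
    define h where "h = elem_len xs"
    define E where "E = (\<lambda>i j. integral {xs ! (j - 1)..xs ! j} (\<lambda>x. (D i x - poly ((pderiv ^^ i) (P j)) x)\<^sup>2))"
    define T where "T = (\<lambda>j. (h j / 2) ^ (2 * p + 3 - 2 * k) * (D (p + 1) (elem_mid xs j) / fact (p + 1 - k))\<^sup>2 * leading_const p m k)"
    have h: "0 < h j" "h j \<le> H" "H \<le> b - a" if "j \<in> {1..N}" for j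
      using elem_len_mesh[OF part] that by (auto simp: h_def H_def N_def)
    have sum_h: "(\<Sum>j = 1..N. h j) = b - a"
      unfolding h_def N_def by (rule sum_elem_len_partition[OF part])
    have H: "0 \<le> H" "H \<le> b - a"
      using h[of 1] partition_nodes(1)[OF part] by (auto simp: N_def)
    have lead: "leading_term p m k a b u xs = (\<Sum>j = 1..N. T j)"
      by (simp only: leading_term_def T_def h_def N_def leading_const_def)
    have "(\<Sum>i\<le>k. \<Sum>j = 1..N. E i j) = (\<Sum>j = 1..N. E k j) + (\<Sum>i<k. \<Sum>j = 1..N. E i j)"
      by (simp add: lessThan_Suc_atMost[symmetric])
    then have split: "(sobolev_norm k a b (\<lambda>x. u x - W x))\<^sup>2 - leading_term p m k a b u xs =
      (\<Sum>j = 1..N. E k j - T j) + (\<Sum>i<k. \<Sum>j = 1..N. E i j)"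
      unfolding norm lead E_def N_def by (simp add: sum_subtractf)
    have top: "\<bar>\<Sum>j = 1..N. E k j - T j\<bar> \<le> K k * (b - a) * H ^ (2 * p + 3 - 2 * k)"
    proof -
      have "\<bar>E k j - T j\<bar> \<le> K k * H ^ (2 * p + 3 - 2 * k) * h j" if j: "j \<in> {1..N}" for j
      proof -
        have "T j = (h j / 2) ^ (2 * p + 3 - 2 * k) * (D (p + 1) (elem_mid xs j) / fact (p + 1))\<^sup>2 * I k"
          unfolding T_def I_def HJ_remainder_norm[OF pm k] leading_const_def[symmetric]
          by (simp add: power_divide del: fact_Suc nth_deriv_within.simps(2))
        then have "\<bar>E k j - T j\<bar> \<le> K k * h j ^ (2 * p + 4 - 2 * k)"
          using K1[OF order_refl P[of j]] j by (simp only: E_def N_def h_def elem_len_def elem_mid_def)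
        also have "2 * p + 4 - 2 * k = Suc (2 * p + 3 - 2 * k)"
          using k pm by simp
        also have "K k * h j ^ Suc (2 * p + 3 - 2 * k) \<le> K k * (H ^ (2 * p + 3 - 2 * k) * h j)"
          unfolding power_Suc2 using h[OF j] K by (intro mult_left_mono mult_right_mono power_mono) auto
        finally show ?thesis
          by (simp add: mult.assoc)
      qed
      then have "\<bar>\<Sum>j = 1..N. E k j - T j\<bar> \<le> (\<Sum>j = 1..N. K k * H ^ (2 * p + 3 - 2 * k) * h j)"
        by (intro order_trans[OF sum_abs sum_mono])
      then show ?thesis
        unfolding sum_distrib_left[symmetric] sum_h by (simp only: mult_ac)
    qed
    have low: "\<bar>\<Sum>j = 1..N. E i j\<bar> \<le> K i * (b - a) ^ (2 * (k - i) - 1) * (b - a) * H ^ (2 * p + 3 - 2 * k)"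
      if i: "i < k" for i
    proof -
      have "\<bar>E i j\<bar> \<le> K i * (b - a) ^ (2 * (k - i) - 1) * H ^ (2 * p + 3 - 2 * k) * h j" if j: "j \<in> {1..N}" for j
      proof -
        have "a \<le> xs ! (j - 1)" "xs ! j \<le> b"
          using P[of j] j by (auto simp: interpolates_def N_def)
        then have "0 \<le> E i j"
          unfolding E_def using D_cont[of i] i k pm
          by (intro integral_nonneg integrable_continuous_real continuous_intros)
            (auto elim!: continuous_on_subset)
        then have "\<bar>E i j\<bar> \<le> K i * h j ^ (2 * p + 3 - 2 * i)"
          using K2[OF less_imp_le[OF i] P[of j]] j by (simp add: E_def N_def h_def elem_len_def)
        \<comment> \<open>One factor h_j is reserved for the sum of the lengths and 2p+3-2k factors
          for the power of H; the surplus 2(k-i)-1 is positive and bounded through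
          \<open>b - a\<close>.\<close>
        also have "2 * p + 3 - 2 * i = Suc ((2 * (k - i) - 1) + (2 * p + 3 - 2 * k))"
          using i k pm by simp
        also have "h j ^ Suc ((2 * (k - i) - 1) + (2 * p + 3 - 2 * k)) =
            h j ^ (2 * (k - i) - 1) * h j ^ (2 * p + 3 - 2 * k) * h j"
          by (simp add: power_add)
        also have "K i * (h j ^ (2 * (k - i) - 1) * h j ^ (2 * p + 3 - 2 * k) * h j) \<le>
            K i * ((b - a) ^ (2 * (k - i) - 1) * H ^ (2 * p + 3 - 2 * k) * h j)"
          using h[OF j] K i by (intro mult_left_mono mult_right_mono mult_mono power_mono) auto
        finally show ?thesis
          by (simp add: mult.assoc)
      qed
      then have "\<bar>\<Sum>j = 1..N. E i j\<bar> \<le> (\<Sum>j = 1..N. K i * (b - a) ^ (2 * (k - i) - 1) * H ^ (2 * p + 3 - 2 * k) * h j)"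
        by (intro order_trans[OF sum_abs sum_mono])
      then show ?thesis
        unfolding sum_distrib_left[symmetric] sum_h by (simp only: mult_ac)
    qed
    have "\<bar>\<Sum>i<k. \<Sum>j = 1..N. E i j\<bar> \<le> (\<Sum>i<k. K i * (b - a) ^ (2 * (k - i) - 1) * (b - a) * H ^ (2 * p + 3 - 2 * k))"
      using low by (intro order_trans[OF sum_abs sum_mono]) auto
    with top show "\<bar>(sobolev_norm k a b (\<lambda>x. u x - W x))\<^sup>2 - leading_term p m k a b u xs\<bar>
      \<le> (K k * (b - a) + (\<Sum>i<k. K i * (b - a) ^ (2 * (k - i) - 1) * (b - a))) * mesh xs ^ (2 * p + 3 - 2 * k)"
      unfolding split distrib_right sum_distrib_right H_def by linarith
  qed
qed

text \<open>The square of the derivative of order \<open>p + 1\<close> is Lipschitz, because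
  \<open>u\<close> has one more continuous derivative. Replacing its midpoint value by its mean over
  the element thus costs O(H), which supplies the additional power in the remainder.\<close>

lemma leading_term_bound:
  assumes k: "k \<le> m + 1" and C: "leading_const p m k \<le> C"
  obtains K where "\<And>xs. is_partition a b xs \<Longrightarrow> leading_term p m k a b u xs \<le>
    C * mesh xs ^ (2 * p + 2 - 2 * k) * (sobolev_norm (p + 1) a b u)\<^sup>2 + K * mesh xs ^ (2 * p + 3 - 2 * k)"
proof -
  define g where "g = (\<lambda>x. (D (p + 1) x)\<^sup>2)"
  obtain M1 where M1: "0 < M1" "\<And>x. x \<in> {a..b} \<Longrightarrow> \<bar>D (p + 1) x\<bar> \<le> M1"
    using D_bound[of "p + 1"] by auto
  obtain M2 where M2: "0 < M2" "\<And>x. x \<in> {a..b} \<Longrightarrow> \<bar>D (p + 2) x\<bar> \<le> M2"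
    using D_bound[of "p + 2"] by auto
  \<comment> \<open>From |s^2 - t^2| = |s - t| |s + t|, with the first factor controlled by
    \<open>M2\<close> and the second by twice \<open>M1\<close>.\<close>
  define L where "L = M2 * (2 * M1)"
  have lip: "g y \<le> g x + L * \<bar>x - y\<bar>" if "x \<in> {a..b}" "y \<in> {a..b}" for x y
  proof -
    have "norm (D (p + 1) y - D (p + 1) x) \<le> M2 * norm (y - x)"
      using that M2 D_deriv[of "p + 1"]
      by (intro field_differentiable_bound[of "{a..b}" _ "D (p + 2)"]) auto
    moreover have "\<bar>D (p + 1) y + D (p + 1) x\<bar> \<le> 2 * M1"
      using M1(2)[OF that(1)] M1(2)[OF that(2)] by linarith
    ultimately have "\<bar>D (p + 1) y - D (p + 1) x\<bar> * \<bar>D (p + 1) y + D (p + 1) x\<bar> \<le> M2 * \<bar>y - x\<bar> * (2 * M1)"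
      using M2(1) by (intro mult_mono) auto
    moreover have "\<bar>D (p + 1) y - D (p + 1) x\<bar> * \<bar>D (p + 1) y + D (p + 1) x\<bar> = \<bar>g y - g x\<bar>"
      by (simp add: g_def power2_eq_square algebra_simps flip: abs_mult)
    moreover have "M2 * \<bar>y - x\<bar> * (2 * M1) = L * \<bar>x - y\<bar>"
      by (simp add: L_def abs_minus_commute)
    ultimately show ?thesis
      by linarith
  qed
  have g_cont: "continuous_on {a..b} g"
    unfolding g_def using D_cont[of "p + 1"] by (intro continuous_intros) auto
  have g_le: "integral {a..b} g \<le> (sobolev_norm (p + 1) a b u)\<^sup>2"
  proof -
    have "0 \<le> integral {a..b} (\<lambda>x. (D i x)\<^sup>2)" if "i \<le> p + 1" for i
      using D_cont[of i] that by (intro integral_nonneg integrable_continuous_real continuous_intros) auto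
    then have "integral {a..b} (\<lambda>x. (D (p + 1) x)\<^sup>2) \<le> (\<Sum>i\<le>p + 1. integral {a..b} (\<lambda>x. (D i x)\<^sup>2))"
      by (intro member_le_sum) auto
    then show ?thesis
      using sobolev_norm_D[of "p + 1"] by (simp add: g_def)
  qed
  have L: "0 \<le> L"
    using M1 M2 by (simp add: L_def)
  have C0: "0 \<le> C"
    using leading_const_nonneg[OF pm k] C by linarith
  show ?thesis
  proof (rule that[of "C * (L * (b - a))"])
    fix xs assume part: "is_partition a b xs"
    define N where "N = num_elems xs"
    define H where "H = mesh xs"
    define h where "h = elem_len xs"
    define n where "n = 2 * p + 2 - 2 * k"
    have n: "2 * p + 3 - 2 * k = Suc n"
      using k pm by (simp add: n_def)
    have h: "0 < h j" "h j \<le> H" "H \<le> b - a" if "j \<in> {1..N}" for j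
      using elem_len_mesh[OF part] that by (auto simp: h_def H_def N_def)
    have sum_h: "(\<Sum>j = 1..N. h j) = b - a"
      unfolding h_def N_def by (rule sum_elem_len_partition[OF part])
    have H: "0 \<le> H"
      using h[of 1] partition_nodes(1)[OF part] by (auto simp: N_def)
    have term_le: "(h j / 2) ^ Suc n * (D (p + 1) (elem_mid xs j) / fact (p + 1 - k))\<^sup>2 * leading_const p m k
        \<le> C * H ^ n * (integral {xs ! (j - 1)..xs ! j} g + L * H * h j)" if j: "j \<in> {1..N}" for j
    proof -
      define c where "c = xs ! (j - 1)"
      define d where "d = xs ! j"
      have cd: "a \<le> c" "c < d" "d \<le> b" "h j = d - c" "elem_mid xs j = (c + d) / 2"
        using partition_nodes_le[OF part, of 0 "j - 1"] partition_nodes_le[OF part, of j N]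
          partition_nodes[OF part] partition_nodes(4)[OF part, of "j - 1" j] j
        by (auto simp: c_def d_def h_def elem_len_def elem_mid_def N_def)
      have mid: "h j * g (elem_mid xs j) \<le> integral {c..d} g + L * h j * h j"
      proof -
        have "integral {c..d} (\<lambda>x. g (elem_mid xs j) - L * h j) \<le> integral {c..d} g"
        proof (rule integral_le)
          show "g integrable_on {c..d}"
            using g_cont cd by (intro integrable_continuous_real) (auto elim!: continuous_on_subset)
          fix x assume x: "x \<in> {c..d}"
          have "g (elem_mid xs j) \<le> g x + L * \<bar>x - elem_mid xs j\<bar>"
            using cd x by (intro lip) auto
          also have "\<dots> \<le> g x + L * h j"
            using cd x L by (intro add_left_mono mult_left_mono) (auto simp: abs_le_iff)
          finally show "g (elem_mid xs j) - L * h j \<le> g x"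
            by simp
        qed auto
        then have "(g (elem_mid xs j) - L * h j) * h j \<le> integral {c..d} g"
          using cd(2,4) by (simp add: mult.commute)
        then show ?thesis
          by (simp add: algebra_simps)
      qed
      have "(D (p + 1) (elem_mid xs j) / fact (p + 1 - k))\<^sup>2 \<le> g (elem_mid xs j)"
      proof -
        have "(1 :: real) \<le> (fact (p + 1 - k))\<^sup>2"
          using fact_ge_1 by (rule one_le_power)
        then show ?thesis
          unfolding g_def power_divide by (simp add: divide_le_eq mult_le_cancel_left1 del: fact_Suc nth_deriv_within.simps(2))
      qed
      moreover have "(h j / 2) ^ Suc n \<le> H ^ n * h j"
      proof -
        have "(h j / 2) ^ Suc n \<le> h j ^ Suc n"
          using h[OF j] by (intro power_mono) auto
        also have "\<dots> \<le> H ^ n * h j"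
          unfolding power_Suc2 using h[OF j] by (intro mult_right_mono power_mono) auto
        finally show ?thesis .
      qed
      ultimately have "(h j / 2) ^ Suc n * (D (p + 1) (elem_mid xs j) / fact (p + 1 - k))\<^sup>2 * leading_const p m k
          \<le> H ^ n * h j * g (elem_mid xs j) * C"
        using h[OF j] H C leading_const_nonneg[OF pm k] by (intro mult_mono) (auto simp: g_def)
      also have "\<dots> = C * H ^ n * (h j * g (elem_mid xs j))"
        by simp
      also have "\<dots> \<le> C * H ^ n * (integral {c..d} g + L * H * h j)"
      proof (intro mult_left_mono order_trans[OF mid] add_left_mono)
        show "L * h j * h j \<le> L * H * h j"
          using h[OF j] L by (intro mult_right_mono mult_left_mono) auto
      qed (use C0 H in auto)
      finally show ?thesis
        by (simp add: c_def d_def)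
    qed
    have "leading_term p m k a b u xs \<le> (\<Sum>j = 1..N. C * H ^ n * (integral {xs ! (j - 1)..xs ! j} g + L * H * h j))"
      unfolding leading_term_def leading_const_def[symmetric] n N_def[symmetric] h_def[symmetric]
      by (rule sum_mono) (rule term_le)
    also have "\<dots> = C * H ^ n * (integral {a..b} g + L * H * (b - a))"
      unfolding sum_distrib_left[symmetric] sum.distrib sum_h
      using integral_partition[OF part, of g] g_cont by (simp add: N_def integrable_continuous_real)
    also have "\<dots> \<le> C * H ^ n * ((sobolev_norm (p + 1) a b u)\<^sup>2 + L * H * (b - a))"
      using g_le C0 H by (intro mult_left_mono add_right_mono) auto
    also have "\<dots> = C * H ^ n * (sobolev_norm (p + 1) a b u)\<^sup>2 + C * (L * (b - a)) * H ^ Suc n"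
      by (simp add: algebra_simps)
    finally show "leading_term p m k a b u xs \<le> C * mesh xs ^ (2 * p + 2 - 2 * k) * (sobolev_norm (p + 1) a b u)\<^sup>2
      + C * (L * (b - a)) * mesh xs ^ (2 * p + 3 - 2 * k)"
      by (simp only: n H_def n_def)
  qed
qed

end

section \<open>Combination of the expansion with the bound on its leading term\<close>

theorem theorem3p16:
  shows "\<exists>C :: nat \<Rightarrow> nat \<Rightarrow> real.
    \<forall>(m::nat) (p::nat) (k::nat) (a::real) (b::real) (u :: real \<Rightarrow> real)
      (\<beta>\<^sub>0::real) (W :: real list \<Rightarrow> real \<Rightarrow> real).
      2 * m + 1 \<le> p \<longrightarrow> k \<le> m + 1 \<longrightarrow> a < b \<longrightarrow> Ck_on (p + 2) {a..b} u \<longrightarrow> 0 < \<beta>\<^sub>0 \<longrightarrow>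
      (\<forall>xs\<in>quasi_uniform \<beta>\<^sub>0 a b. is_HJ_interpolant p m a b u xs (W xs)) \<longrightarrow>
      (\<exists>R\<^sub>1 R\<^sub>2 :: real list \<Rightarrow> real.
        R\<^sub>1 \<in> O[refinement \<beta>\<^sub>0 a b](\<lambda>xs. mesh xs ^ (2 * p + 3 - 2 * k)) \<and>
        R\<^sub>2 \<in> O[refinement \<beta>\<^sub>0 a b](\<lambda>xs. mesh xs ^ (2 * p + 3 - 2 * k)) \<and>
        (\<forall>xs\<in>quasi_uniform \<beta>\<^sub>0 a b.
          (sobolev_norm k a b (\<lambda>x. u x - W xs x))\<^sup>2 = leading_term p m k a b u xs + R\<^sub>1 xs \<and>
          leading_term p m k a b u xs + R\<^sub>1 xs \<le>
            C p m * mesh xs ^ (2 * p + 2 - 2 * k) * (sobolev_norm (p + 1) a b u)\<^sup>2 + R\<^sub>2 xs))"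
proof (intro exI[of _ "\<lambda>p m. \<Sum>k\<le>m + 1. leading_const p m k"] allI impI)
  fix m p k :: nat and a b :: real and u :: "real \<Rightarrow> real" and \<beta>\<^sub>0 :: real and W :: "real list \<Rightarrow> real \<Rightarrow> real"
  assume pm: "2 * m + 1 \<le> p" and k: "k \<le> m + 1" and "a < b" "Ck_on (p + 2) {a..b} u"
    and W: "\<forall>xs\<in>quasi_uniform \<beta>\<^sub>0 a b. is_HJ_interpolant p m a b u xs (W xs)"
  then interpret interpolation_setting a b u p m
    by unfold_locales
  \<comment> \<open>The constant must not depend on \<open>k\<close>, so the nonnegative constants
    of all admissible orders are added up.\<close>
  let ?C = "\<Sum>k\<le>m + 1. leading_const p m k"
  define e where "e = 2 * p + 3 - 2 * k"
  obtain K1 where K1: "\<And>xs W. is_partition a b xs \<Longrightarrow> is_HJ_interpolant p m a b u xs W \<Longrightarrow>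
    \<bar>(sobolev_norm k a b (\<lambda>x. u x - W x))\<^sup>2 - leading_term p m k a b u xs\<bar> \<le> K1 * mesh xs ^ e"
    using error_expansion[OF k, folded e_def] by blast
  have "leading_const p m k \<le> ?C"
    using k by (intro member_le_sum) (auto intro: leading_const_nonneg[OF pm])
  then obtain K2 where K2: "\<And>xs. is_partition a b xs \<Longrightarrow> leading_term p m k a b u xs \<le>
    ?C * mesh xs ^ (2 * p + 2 - 2 * k) * (sobolev_norm (p + 1) a b u)\<^sup>2 + K2 * mesh xs ^ e"
    using leading_term_bound[OF k, folded e_def] by blast
  define R\<^sub>1 where "R\<^sub>1 = (\<lambda>xs. (sobolev_norm k a b (\<lambda>x. u x - W xs x))\<^sup>2 - leading_term p m k a b u xs)"
  \<comment> \<open>The inequality bounds the leading term together with \<open>R\<^sub>1\<close>,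
    so \<open>R\<^sub>1\<close> reappears on the right, next to the error of the midpoint
    sum.\<close>
  define R\<^sub>2 where "R\<^sub>2 = (\<lambda>xs. R\<^sub>1 xs + K2 * mesh xs ^ e)"
  have R1: "R\<^sub>1 \<in> O[refinement \<beta>\<^sub>0 a b](\<lambda>xs. mesh xs ^ e)"
  proof (rule bigoI[of _ K1])
    have "norm (R\<^sub>1 xs) \<le> K1 * norm (mesh xs ^ e)" if "xs \<in> quasi_uniform \<beta>\<^sub>0 a b" for xs
    proof -
      have part: "is_partition a b xs"
        using that by (simp add: quasi_uniform_def)
      have "0 \<le> mesh xs"
        using elem_len_mesh[OF part, of 1] partition_nodes(1)[OF part] by auto
      then show ?thesis
        using K1[OF part] W that by (simp add: R\<^sub>1_def)
    qed
    then show "eventually (\<lambda>xs. norm (R\<^sub>1 xs) \<le> K1 * norm (mesh xs ^ e)) (refinement \<beta>\<^sub>0 a b)"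
      unfolding refinement_def eventually_inf_principal by (intro always_eventually) blast
  qed
  moreover from R1 have "R\<^sub>2 \<in> O[refinement \<beta>\<^sub>0 a b](\<lambda>xs. mesh xs ^ e)"
    unfolding R\<^sub>2_def by (intro sum_in_bigo) auto
  moreover have "leading_term p m k a b u xs + R\<^sub>1 xs \<le>
      ?C * mesh xs ^ (2 * p + 2 - 2 * k) * (sobolev_norm (p + 1) a b u)\<^sup>2 + R\<^sub>2 xs" if "xs \<in> quasi_uniform \<beta>\<^sub>0 a b" for xs
    using K2[of xs] that by (simp add: R\<^sub>2_def quasi_uniform_def)
  ultimately show "\<exists>R\<^sub>1 R\<^sub>2 :: real list \<Rightarrow> real.
        R\<^sub>1 \<in> O[refinement \<beta>\<^sub>0 a b](\<lambda>xs. mesh xs ^ (2 * p + 3 - 2 * k)) \<and>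
        R\<^sub>2 \<in> O[refinement \<beta>\<^sub>0 a b](\<lambda>xs. mesh xs ^ (2 * p + 3 - 2 * k)) \<and>
        (\<forall>xs\<in>quasi_uniform \<beta>\<^sub>0 a b.
          (sobolev_norm k a b (\<lambda>x. u x - W xs x))\<^sup>2 = leading_term p m k a b u xs + R\<^sub>1 xs \<and>
          leading_term p m k a b u xs + R\<^sub>1 xs \<le>
            ?C * mesh xs ^ (2 * p + 2 - 2 * k) * (sobolev_norm (p + 1) a b u)\<^sup>2 + R\<^sub>2 xs)"
    unfolding e_def by (intro exI[of _ R\<^sub>1] exI[of _ R\<^sub>2]) (auto simp: R\<^sub>1_def)
qed

end
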